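(* Let $(\mathbf{Z}_n)_{n\ge 0}$ and $\mathbf{F}$ be as in the context, with a general strictly increasing $f\in\mathcal{C}^1([0,1])$ with values in $[0,1]$. If $f(0)>0$ and $f(1)<1$, then for each linearly unstable zero $\mathbf{z}\in\mathcal{Z}(\mathbf{F})$ we have $$P(\mathbf{Z}_n\to\mathbf{z})=0 .$$
   Context: Model. Let $N\ge 2$, $\alpha,\beta\in[0,1)$ with $\alpha+\beta\in(0,1)$, $q\in(0,1]$, and let $f:[0,1]\to[0,1]$ be strictly increasing and of class $\mathcal{C}^1([0,1])$. Let $(r_n)_{n\ge0}$ be a deterministic sequence in $[0,1]$ with $\lim_{n\to\infty} n r_n=1$. Let $Z_{0,h}$, $1\le h\le N$, be random variables with values in $[0,1]$. For $n\ge 0$ and $1\le h\le N$ set $Z_{n+1,h}=(1-r_n)Z_{n,h}+r_nI_{n+1,h}$, where the $I_{n+1,h}$ take values in $\{0,1\}$ and, given $\mathcal{F}_n=\sigma(Z_{0,h}:1\le h\le N)\vee\sigma(I_{k,h}:1\le k\le n,\,1\le h\le N)$, the variables $I_{n+1,1},\dots,I_{n+1,N}$ are conditionally independent with $$P(I_{n+1,h}=1\mid\mathcal{F}_n)=\alpha Z_n+\beta q+(1-\alpha-\beta)f(Z_{n,h}),\qquad Z_n=\frac1N\sum_{i=1}^N Z_{n,i}.$$ Write $\mathbf{Z}_n=(Z_{n,1},\dots,Z_{n,N})^\top$. Define $\mathbf{F}=(F_1,\dots,F_N)^\top$ on $[0,1]^N$ by $$F_h(\mathbf{z})=\alpha\frac1N\sum_{i=1}^Nz_i+\beta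 q+(1-\alpha-\beta)f(z_h)-z_h ,$$ and $\mathcal{Z}(\mathbf{F})=\{\mathbf{z}\in[0,1]^N:\mathbf{F}(\mathbf{z})=\mathbf{0}\}$. A zero $\mathbf{z}$ of $\mathbf{F}$ is linearly unstable if the Jacobian matrix of $\mathbf{F}$ at $\mathbf{z}$ has at least one eigenvalue with strictly positive real part. *)

theory Defs
  imports "HOL-Probability.Probability"
begin

text \<open>
  The index set of the \<open>N\<close> components is a finite type \<open>'n\<close>, so that \<open>N = CARD('n)\<close> and
  vectors indexed by \<open>1, \<dots>, N\<close> are elements of \<open>real ^ 'n\<close>. The unit cube is \<open>cbox 0 1\<close>.
\<close>

definition mean :: "real ^ 'n \<Rightarrow> real" where
  "mean z = (\<Sum>i\<in>UNIV. z $ i) / real CARD('n)"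

definition field_F :: "real \<Rightarrow> real \<Rightarrow> real \<Rightarrow> (real \<Rightarrow> real) \<Rightarrow> real ^ 'n \<Rightarrow> real ^ 'n" where
  "field_F \<alpha> \<beta> q f z =
     (\<chi> h. \<alpha> * mean z + \<beta> * q + (1 - \<alpha> - \<beta>) * f (z $ h) - z $ h)"

definition zeros_on :: "(real ^ 'n) set \<Rightarrow> (real ^ 'n \<Rightarrow> real ^ 'n) \<Rightarrow> (real ^ 'n) set" where
  "zeros_on S F = {z \<in> S. F z = 0}"

text \<open>
  Derivatives are relative to the interval (one-sided at the end points), so that values of
  \<open>f\<close> outside the interval are irrelevant; the library's \<open>C1_differentiable_on\<close> would ask for
  two-sided derivatives at the end points.
\<close>

definition C1_on_interval :: "real \<Rightarrow> real \<Rightarrow> (real \<Rightarrow> real) \<Rightarrow> bool" where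
  "C1_on_interval a b f \<longleftrightarrow>
     (\<exists>f'. (\<forall>x\<in>{a..b}. (f has_real_derivative f' x) (at x within {a..b})) \<and>
           continuous_on {a..b} f')"

text \<open>Eigenvalues of a real matrix are taken over the complex numbers.\<close>

definition complex_eigenvalue :: "real ^ 'n ^ 'n \<Rightarrow> complex \<Rightarrow> bool" where
  "complex_eigenvalue A c \<longleftrightarrow>
     (\<exists>v :: complex ^ 'n. v \<noteq> 0 \<and> map_matrix complex_of_real A *v v = c *s v)"

text \<open>
  The Jacobian is the one relative to the domain \<open>S\<close> of \<open>F\<close>. On the unit cube the
  relative derivative is unique, also at boundary points
  (\<open>frechet_derivative_unique_within_closed_interval\<close>).
\<close>

definition linearly_unstable :: "(real ^ 'n) set \<Rightarrow> (real ^ 'n \<Rightarrow> real ^ 'n) \<Rightarrow> real ^ 'n \<Rightarrow> bool" where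
  "linearly_unstable S F z \<longleftrightarrow>
     (\<exists>c. complex_eigenvalue (jacobian F (at z within S)) c \<and> Re c > 0)"

text \<open>\<open>history M Z I n\<close> is the sigma-algebra generated by \<open>Z 0 $ h\<close> and by \<open>I k h\<close> for \<open>1 \<le> k \<le> n\<close>.\<close>

definition history ::
  "'a measure \<Rightarrow> (nat \<Rightarrow> 'a \<Rightarrow> real ^ 'n) \<Rightarrow> (nat \<Rightarrow> 'n \<Rightarrow> 'a \<Rightarrow> real) \<Rightarrow> nat \<Rightarrow> 'a measure" where
  "history M Z I n = sigma (space M)
     ({(\<lambda>\<omega>. Z 0 \<omega> $ h) -` A \<inter> space M | h A. A \<in> sets borel} \<union>
      {I k h -` A \<inter> space M | k h A. k \<in> {1..n} \<and> A \<in> sets borel})"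

definition cond_probability :: "'a measure \<Rightarrow> 'a measure \<Rightarrow> 'a set \<Rightarrow> 'a \<Rightarrow> real" where
  "cond_probability M G B = real_cond_exp M G (indicator B)"

text \<open>Conditional analogue of \<open>prob_space.indep_vars\<close>: the \<open>X i\<close>, \<open>i \<in> J\<close>, are independent given \<open>G\<close>.\<close>

definition cond_indep_vars ::
  "'a measure \<Rightarrow> 'a measure \<Rightarrow> ('i \<Rightarrow> 'b measure) \<Rightarrow> ('i \<Rightarrow> 'a \<Rightarrow> 'b) \<Rightarrow> 'i set \<Rightarrow> bool" where
  "cond_indep_vars M G M' X J \<longleftrightarrow>
     (\<forall>i\<in>J. X i \<in> measurable M (M' i)) \<and>
     (\<forall>K A. K \<subseteq> J \<and> K \<noteq> {} \<and> finite K \<and> (\<forall>i\<in>K. A i \<in> sets (M' i)) \<longrightarrow>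
        (AE \<omega> in M. cond_probability M G (\<Inter>i\<in>K. X i -` A i \<inter> space M) \<omega> =
           (\<Prod>i\<in>K. cond_probability M G (X i -` A i \<inter> space M) \<omega>)))"

end

theory Submission
  imports Defs
begin

text \<open>
  Two copies of the chain started from ordered points can be coupled so that they stay ordered,
  since every success probability is increasing in the state. Near an unstable zero there are
  weights \<open>v \<ge> 0\<close> with \<open>J v \<ge> \<nu> v\<close>, \<open>\<nu> > 0\<close>, where \<open>J\<close> is the (symmetric) Jacobian, so the weighted
  distance \<open>D\<close> of the two copies has drift at least \<open>(\<nu> / 2) D / n\<close>; its noise is driven by the
  drift itself, so that \<open>exp (- \<theta> D)\<close> is a supermartingale for \<open>\<theta>\<close> of order \<open>n\<close>, even if \<open>\<theta>\<close>
  then tends slowly to \<open>0\<close>. Since \<open>f\<close> is only \<open>C\<^sup>1\<close>, it matters that the linearization is applied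
  to a difference of two trajectories near the zero. Since flipping a single innovation at time \<open>n\<close> separates two copies by order
  \<open>1 / n\<close>, they cannot both stay near the zero with probability close to \<open>1\<close>; and since both
  values of the innovation have probability bounded below, the chain leaves the neighbourhood
  after time \<open>n\<close> with conditional probability bounded below uniformly in \<open>n\<close>. Hence it almost
  surely does not stay there forever.
\<close>

section \<open>Products of Bernoulli distributions\<close>

text \<open>The expectation of \<open>G\<close> under independent Bernoulli coordinates, written as
  a finite sum: it is then a polynomial in \<open>p\<close>, so that measurability in a state on
  which \<open>p\<close> depends is immediate.\<close>

definition bernoulli_mean :: "('n::finite \<Rightarrow> real) \<Rightarrow> (('n \<Rightarrow> bool) \<Rightarrow> real) \<Rightarrow> real" where
  "bernoulli_mean p G = (\<Sum>i\<in>UNIV. (\<Prod>h\<in>UNIV. if i h then p h else 1 - p h) * G i)"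

lemma expectation_Pi_pmf_bernoulli:
  fixes p :: "'n::finite \<Rightarrow> real"
  assumes "\<And>h. 0 \<le> p h \<and> p h \<le> 1"
  shows "measure_pmf.expectation (Pi_pmf UNIV d (\<lambda>h. bernoulli_pmf (p h))) G = bernoulli_mean p G"
proof -
  have "pmf (bernoulli_pmf (p h)) (i h) = (if i h then p h else 1 - p h)" for i h
    using assms by (cases "i h") auto
  then have "pmf (Pi_pmf UNIV d (\<lambda>h. bernoulli_pmf (p h))) i = (\<Prod>h\<in>UNIV. if i h then p h else 1 - p h)" for i
    by (subst pmf_Pi') (auto intro!: prod.cong)
  then show ?thesis
    by (subst integral_measure_pmf[where A = UNIV]) (auto simp: bernoulli_mean_def)
qed

lemma bernoulli_mean_mono:
  assumes "\<And>h. 0 \<le> p h \<and> p h \<le> 1" "\<And>i. G i \<le> G' i"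
  shows "bernoulli_mean p G \<le> bernoulli_mean p G'"
  unfolding bernoulli_mean_def
  using assms by (intro sum_mono mult_left_mono prod_nonneg) auto

lemma bernoulli_mean_const:
  fixes p :: "'n::finite \<Rightarrow> real"
  assumes "\<And>h. 0 \<le> p h \<and> p h \<le> 1"
  shows "bernoulli_mean p (\<lambda>_. c) = c"
  using expectation_Pi_pmf_bernoulli[where p = p and d = False and G = "\<lambda>_. c"] assms by simp

text \<open>Thinning: a success of probability \<open>p'\<close> is kept with probability
  \<open>p / p'\<close>, independently. For \<open>p' = 0\<close> the quotient is \<open>0\<close>
  and both sides are concentrated on \<open>False\<close>.\<close>

lemma map_pmf_and_bernoulli:
  assumes "0 \<le> p" "p \<le> p'" "p' \<le> 1"
  shows "map_pmf (\<lambda>(b, c). b \<and> c) (pair_pmf (bernoulli_pmf p') (bernoulli_pmf (p / p'))) = bernoulli_pmf p"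
proof -
  have q: "0 \<le> p / p'" "p / p' \<le> 1" "p' * (p / p') = p"
    using assms by (auto simp: divide_le_eq_1)
  have T: "(\<lambda>(b, c). b \<and> c) -` {True} = {(True, True)}" by auto
  have "pmf (map_pmf (\<lambda>(b, c). b \<and> c) (pair_pmf (bernoulli_pmf p') (bernoulli_pmf (p / p')))) True = p"
    using assms q unfolding pmf_map T by (simp add: measure_pmf_single pmf_pair)
  then show ?thesis
    using assms by (intro pmf_eqI) (metis (full_types) pmf_bernoulli_True pmf_False_conv_True order_trans)
qed

text \<open>The two products of Bernoulli laws are realized by one monotone coupling.\<close>

lemma bernoulli_mean_coupling:
  fixes p p' a :: "'n::finite \<Rightarrow> real"
  assumes p: "\<And>h. 0 \<le> p h" "\<And>h. p h \<le> p' h" "\<And>h. p' h \<le> 1"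
    and C: "0 \<le> C"
    and G: "\<And>i i'. (\<And>h. i h \<le> i' h) \<Longrightarrow>
      G i + G' i' \<le> 1 + C * exp (- (\<Sum>h\<in>UNIV. a h * (of_bool (i' h) - of_bool (i h))))"
  shows "bernoulli_mean p G + bernoulli_mean p' G' \<le> 1 + C * (\<Prod>h\<in>UNIV. 1 - (p' h - p h) * (1 - exp (- a h)))"
proof -
  \<comment> \<open>Each coordinate carries a bit of mean \<open>p'\<close> and an independent
    thinning bit. \<open>hi\<close> reads the first and \<open>lo\<close> the conjunction, so
    \<open>lo s h \<le> hi s h\<close> always, and the marginals are the two given product
    laws.\<close>
  define K where "K h = pair_pmf (bernoulli_pmf (p' h)) (bernoulli_pmf (p h / p' h))" for h
  define Q where "Q = Pi_pmf UNIV (False, False) K"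
  define lo where "lo = (\<lambda>s :: 'n \<Rightarrow> bool \<times> bool. \<lambda>h. fst (s h) \<and> snd (s h))"
  define hi where "hi = (\<lambda>s :: 'n \<Rightarrow> bool \<times> bool. \<lambda>h. fst (s h))"
  define w where "w h = (\<lambda>(b, c). exp (- (a h * (of_bool b - of_bool (b \<and> c)))))" for h
  have int: "integrable (measure_pmf Q) g" for g :: "_ \<Rightarrow> real"
    by (rule integrable_measure_pmf_finite) simp
  have "map_pmf (\<lambda>h. (\<lambda>(b, c). b \<and> c) \<circ> h) Q = Pi_pmf UNIV False (\<lambda>h. map_pmf (\<lambda>(b, c). b \<and> c) (K h))"
    unfolding Q_def by (rule Pi_pmf_map[symmetric]) auto
  moreover have "(\<lambda>h. (\<lambda>(b, c). b \<and> c) \<circ> h) = lo"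
    by (auto simp: lo_def fun_eq_iff split: prod.splits)
  ultimately have "map_pmf lo Q = Pi_pmf UNIV False (\<lambda>h. bernoulli_pmf (p h))"
    using p by (simp add: K_def map_pmf_and_bernoulli)
  then have 1: "bernoulli_mean p G = measure_pmf.expectation Q (\<lambda>s. G (lo s))"
    using p expectation_Pi_pmf_bernoulli[of p False G] by (metis integral_map_pmf order_trans)
  have "map_pmf (\<lambda>h. fst \<circ> h) Q = Pi_pmf UNIV False (\<lambda>h. map_pmf fst (K h))"
    unfolding Q_def by (rule Pi_pmf_map[symmetric]) auto
  then have "map_pmf hi Q = Pi_pmf UNIV False (\<lambda>h. bernoulli_pmf (p' h))"
    by (simp add: hi_def K_def map_fst_pair_pmf comp_def)
  then have 2: "bernoulli_mean p' G' = measure_pmf.expectation Q (\<lambda>s. G' (hi s))"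
    using p expectation_Pi_pmf_bernoulli[of p' False G'] by (metis integral_map_pmf order_trans)
  \<comment> \<open>The two copies differ at \<open>h\<close> exactly when the first bit is set and
    the second is not, which has probability \<open>p' h - p h\<close>; only then is
    \<open>w h\<close> equal to \<open>exp (- a h)\<close> instead of \<open>1\<close>.\<close>
  have "measure_pmf.expectation (K h) (w h) = 1 - (p' h - p h) * (1 - exp (- a h))" for h
  proof -
    have "p h / p' h \<le> 1" using p[of h] by (auto simp: divide_le_eq_1)
    moreover have "0 \<le> p h / p' h" "0 \<le> p' h" using p order_trans[OF p(1,2)] by auto
    moreover have "p' h * (p h / p' h) = p h" using p(1,2)[of h] by auto
    moreover have "p' h * (1 - p h / p' h) = p' h - p h" using p(1,2)[of h] by (auto simp: field_simps)
    moreover have "1 = (p' h * (p h / p' h)) + (p' h * (1 - p h / p' h)) + (1 - p' h) * ((p h / p' h) + (1 - p h / p' h))"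
      by (simp add: algebra_simps)
    moreover have "pmf (K h) (b, c) = (if b then p' h else 1 - p' h) * (if c then p h / p' h else 1 - p h / p' h)" for b c
      using calculation(1-3) p(3)[of h] by (auto simp: K_def pmf_pair)
    moreover have U: "(UNIV :: (bool \<times> bool) set) = {(True, True), (True, False), (False, True), (False, False)}" by auto
    ultimately show ?thesis
      by (subst integral_measure_pmf[where A = UNIV])
        (auto simp: U w_def algebra_simps simp del: UNIV_Times_UNIV)
  qed
  then have 3: "measure_pmf.expectation Q (\<lambda>s. \<Prod>h\<in>UNIV. w h (s h)) = (\<Prod>h\<in>UNIV. 1 - (p' h - p h) * (1 - exp (- a h)))"
    unfolding Q_def
    by (subst expectation_prod_Pi_pmf) (auto simp: w_def split: prod.splits intro!: integrable_measure_pmf_finite)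
  have w: "exp (- (\<Sum>h\<in>UNIV. a h * (of_bool (hi s h) - of_bool (lo s h)))) = (\<Prod>h\<in>UNIV. w h (s h))" for s
    unfolding sum_negf[symmetric] exp_sum[OF finite_class.finite_UNIV] by (simp add: w_def hi_def lo_def case_prod_unfold)
  have "bernoulli_mean p G + bernoulli_mean p' G' = measure_pmf.expectation Q (\<lambda>s. G (lo s) + G' (hi s))"
    unfolding 1 2 by (rule Bochner_Integration.integral_add[symmetric]) (rule int)+
  also have "\<dots> \<le> measure_pmf.expectation Q (\<lambda>s. 1 + C * (\<Prod>h\<in>UNIV. w h (s h)))"
    using G[of "lo _" "hi _"] by (intro integral_mono int) (auto simp: w[symmetric] lo_def hi_def)
  also have "\<dots> = 1 + C * (\<Prod>h\<in>UNIV. 1 - (p' h - p h) * (1 - exp (- a h)))"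
    by (simp add: int 3)
  finally show ?thesis .
qed

text \<open>Given the other coordinates, both values at \<open>h\<close> have probability at least
  \<open>c\<close>. On mass \<open>c\<close> of each, the two values of \<open>G\<close> together
  contribute at most \<open>c * (1 + b)\<close> instead of \<open>2 * c\<close>, a saving of
  \<open>c * (1 - b)\<close>.\<close>

lemma bernoulli_mean_flip:
  fixes p :: "'n::finite \<Rightarrow> real"
  assumes p: "\<And>h. 0 \<le> p h \<and> p h \<le> 1" and c: "0 \<le> c" "c \<le> p h" "p h \<le> 1 - c"
    and G: "\<And>i. G i \<le> 1" "\<And>i. G (i(h := False)) + G (i(h := True)) \<le> 1 + b"
  shows "bernoulli_mean p G \<le> 1 - c * (1 - b)"
proof -
  define flip where "flip = (\<lambda>i :: 'n \<Rightarrow> bool. i(h := \<not> i h))"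
  define R where "R i = (\<Prod>j\<in>UNIV - {h}. if i j then p j else 1 - p j)" for i
  define \<pi> where "\<pi> b = (if b then p h else 1 - p h)" for b
  have flip2: "flip (flip i) = i" for i by (auto simp: flip_def)
  have R0: "0 \<le> R i" for i unfolding R_def using p by (intro prod_nonneg) auto
  have Rflip: "R (flip i) = R i" for i by (auto simp: R_def flip_def intro!: prod.cong)
  have W: "(\<Prod>j\<in>UNIV. if i j then p j else 1 - p j) = \<pi> (i h) * R i" for i
    unfolding R_def \<pi>_def by (simp add: prod.remove[of UNIV h])
  \<comment> \<open>\<open>flip\<close> is an involution that preserves \<open>R\<close> and
    exchanges the two weights at \<open>h\<close>, so the mean is half the sum of itself and its
    reindexed form. This pairs the two configurations that differ only at \<open>h\<close>.\<close>
  have sym: "bernoulli_mean p H = (\<Sum>i\<in>UNIV. R i * (\<pi> (i h) * H i + \<pi> (\<not> i h) * H (flip i))) / 2" for H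
  proof -
    have 1: "bernoulli_mean p H = (\<Sum>i\<in>UNIV. R i * \<pi> (i h) * H i)"
      unfolding bernoulli_mean_def W by (simp add: mult_ac)
    also have "\<dots> = (\<Sum>i\<in>UNIV. R (flip i) * \<pi> (flip i h) * H (flip i))"
      by (rule sum.reindex_bij_witness[of _ flip flip]) (auto simp: flip2)
    also have "\<dots> = (\<Sum>i\<in>UNIV. R i * \<pi> (\<not> i h) * H (flip i))"
      by (simp add: Rflip) (simp add: flip_def)
    finally show ?thesis using 1 by (simp add: algebra_simps sum.distrib)
  qed
  have "\<pi> (i h) * G i + \<pi> (\<not> i h) * G (flip i) \<le> 1 - c * (1 - b)" for i
  proof -
    define x y where "x = G (i(h := False))" and "y = G (i(h := True))"
    have "\<pi> (i h) * G i + \<pi> (\<not> i h) * G (flip i) = (1 - p h) * x + p h * y"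
      by (cases "i h") (auto simp: flip_def \<pi>_def x_def y_def fun_upd_idem)
    \<comment> \<open>Mass \<open>c\<close> is split off from each weight, which leaves nonnegative
      remainders; the pair bound is used on the split part and \<open>G \<le> 1\<close> on the
      rest.\<close>
    also have "\<dots> = c * (x + y) + (1 - p h - c) * x + (p h - c) * y"
      by (simp add: algebra_simps)
    also have "\<dots> \<le> c * (1 + b) + (1 - p h - c) * 1 + (p h - c) * 1"
      using c G(1)[of "i(h := False)"] G(1)[of "i(h := True)"] G(2)[of i] unfolding x_def[symmetric] y_def[symmetric]
      by (intro add_mono[OF add_mono] mult_left_mono) auto
    finally show ?thesis by (simp add: algebra_simps)
  qed
  then have "bernoulli_mean p G \<le> (\<Sum>i\<in>UNIV. R i * (1 - c * (1 - b))) / 2"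
    unfolding sym[of G] using R0 by (intro divide_right_mono sum_mono mult_left_mono) auto
  also have "\<dots> = bernoulli_mean p (\<lambda>_. 1 - c * (1 - b))"
    unfolding sym by (intro arg_cong[where f = "\<lambda>x. x / 2"] sum.cong) (auto simp: \<pi>_def algebra_simps)
  finally show ?thesis by (simp add: bernoulli_mean_const p)
qed

section \<open>Probability of staying in a set\<close>

text \<open>Boolean innovations form a finite type, so one step can be averaged by
  \<open>bernoulli_mean\<close>.\<close>

definition euler_step :: "real \<Rightarrow> real ^ 'n \<Rightarrow> ('n \<Rightarrow> bool) \<Rightarrow> real ^ 'n" where
  "euler_step \<rho> x i = (\<chi> h. (1 - \<rho>) * x $ h + \<rho> * of_bool (i h))"

text \<open>
  The value at \<open>l\<close>, \<open>n\<close>, \<open>x\<close> is the probability that the chain with step sizes \<open>r\<close> and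
  success probabilities \<open>p\<close> that is at \<open>x\<close> at time \<open>n\<close> stays in \<open>U\<close> at the times \<open>n, \<dots>, n + l\<close>.
\<close>

primrec stay_prob ::
  "(nat \<Rightarrow> real) \<Rightarrow> (real ^ 'n \<Rightarrow> 'n \<Rightarrow> real) \<Rightarrow> (real ^ 'n) set \<Rightarrow> nat \<Rightarrow> nat \<Rightarrow> real ^ 'n \<Rightarrow> real" where
  "stay_prob r p U 0 n x = indicator U x"
| "stay_prob r p U (Suc l) n x =
     indicator U x * bernoulli_mean (p x) (\<lambda>i. stay_prob r p U l (Suc n) (euler_step (r n) x i))"

text \<open>Valid probabilities are asked for on \<open>U\<close> only, because the indicator
  annihilates every other state.\<close>

lemma stay_prob_bounds:
  assumes p: "\<And>x h. x \<in> U \<Longrightarrow> 0 \<le> p x h \<and> p x h \<le> 1"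
  shows "0 \<le> stay_prob r p U l n x \<and> stay_prob r p U l n x \<le> 1"
proof (induction l arbitrary: n x)
  case (Suc l)
  show ?case
  proof (cases "x \<in> U")
    case True
    then show ?thesis
      using bernoulli_mean_mono[OF p[OF True], of "\<lambda>_. 0" "\<lambda>i. stay_prob r p U l (Suc n) (euler_step (r n) x i)"]
        bernoulli_mean_mono[OF p[OF True], of "\<lambda>i. stay_prob r p U l (Suc n) (euler_step (r n) x i)" "\<lambda>_. 1"] Suc
      by (simp add: bernoulli_mean_const[OF p[OF True]])
  qed simp
qed simp

lemma stay_prob_outside: "x \<notin> U \<Longrightarrow> stay_prob r p U l n x = 0"
  by (cases l) auto

text \<open>From \<open>exp (- a) \<le> 1 / (1 + a)\<close> one gets
  \<open>1 - exp (- a) \<ge> a / (1 + a) \<ge> (1 - a) * a\<close>. It replaces the exact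
  exponential gain of one step by a linear drift, at the cost of a factor
  \<open>1 - \<eta>\<close>.\<close>

lemma one_minus_exp_neg_ge:
  fixes a \<eta> :: real
  assumes "0 \<le> a" "a \<le> \<eta>"
  shows "(1 - \<eta>) * a \<le> 1 - exp (- a)"
proof -
  have "(1 - a) * (1 + a) \<le> 1" using assms by (simp add: algebra_simps)
  then have "1 - a \<le> 1 / (1 + a)" using assms by (simp add: field_simps)
  then have "(1 - a) * a \<le> 1 / (1 + a) * a" using assms by (intro mult_right_mono)
  moreover have "(1 - \<eta>) * a \<le> (1 - a) * a" using assms by (intro mult_right_mono) auto
  moreover have "1 / (1 + a) * a = 1 - 1 / (1 + a)" using assms by (simp add: field_simps)
  moreover have "exp (- a) \<le> 1 / (1 + a)"
    using exp_ge_add_one_self[of a] assms by (simp add: exp_minus field_simps)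
  ultimately show ?thesis by linarith
qed

text \<open>
  As long as two monotonically coupled copies \<open>x\<^sub>n \<le> y\<^sub>n\<close> both stay in \<open>U\<close>,
  \<open>exp (- \<theta> n * (\<Sum>h. v h * (y\<^sub>n $ h - x\<^sub>n $ h)))\<close> is a supermartingale.
\<close>

lemma stay_prob_pair:
  fixes v :: "'n::finite \<Rightarrow> real" and x y :: "real ^ 'n"
  assumes p: "\<And>x h. x \<in> U \<Longrightarrow> 0 \<le> p x h \<and> p x h \<le> 1"
    and mono: "\<And>x y h. x \<in> U \<Longrightarrow> y \<in> U \<Longrightarrow> (\<And>h. x $ h \<le> y $ h) \<Longrightarrow> p x h \<le> p y h"
    and drift: "\<And>x y. x \<in> U \<Longrightarrow> y \<in> U \<Longrightarrow> (\<And>h. x $ h \<le> y $ h) \<Longrightarrow>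
      (1 + \<mu>) * (\<Sum>h\<in>UNIV. v h * (y $ h - x $ h)) \<le> (\<Sum>h\<in>UNIV. v h * (p y h - p x h))"
    and diam: "\<And>x y. x \<in> U \<Longrightarrow> y \<in> U \<Longrightarrow> (\<Sum>h\<in>UNIV. v h * (y $ h - x $ h)) \<le> C"
    and v: "\<And>h. 0 \<le> v h"
    and r: "\<And>n. 0 \<le> r n \<and> r n \<le> 1"
    and \<theta>: "\<And>n. 0 \<le> \<theta> n"
    and \<theta>_small: "\<And>n h. m \<le> n \<Longrightarrow> \<theta> (Suc n) * r n * v h \<le> \<eta>"
    and \<theta>_decr: "\<And>n. m \<le> n \<Longrightarrow> \<theta> n \<le> \<theta> (Suc n) * (1 + \<kappa> * r n)"
    and \<eta>: "\<eta> \<le> 1" "1 + \<kappa> \<le> (1 - \<eta>) * (1 + \<mu>)"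
    and n: "m \<le> n" and xy: "\<And>h. x $ h \<le> y $ h"
  shows "stay_prob r p U l n x + stay_prob r p U l n y \<le>
    1 + exp (\<theta> (n + l) * C) * exp (- (\<theta> n * (\<Sum>h\<in>UNIV. v h * (y $ h - x $ h))))"
  using n xy
proof (induction l arbitrary: n x y)
  \<comment> \<open>If both points lie in \<open>U\<close>, the left side is \<open>2\<close> and
    the bound \<open>C\<close> on the distance makes the exponential term at least \<open>1\<close>;
    otherwise the left side is at most \<open>1\<close>.\<close>
  case 0
  show ?case
  proof (cases "x \<in> U \<and> y \<in> U")
    case True
    then have "\<theta> n * (\<Sum>h\<in>UNIV. v h * (y $ h - x $ h)) \<le> \<theta> n * C"
      using diam \<theta> by (intro mult_left_mono) auto
    then have "exp 0 \<le> exp (\<theta> n * C + - (\<theta> n * (\<Sum>h\<in>UNIV. v h * (y $ h - x $ h))))"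
      unfolding exp_le_cancel_iff by simp
    then show ?thesis using True by (simp only: exp_add) simp
  next
    case False
    then have "indicator U x + indicator U y \<le> (1::real)" by (auto simp: indicator_def)
    then show ?thesis by (simp add: add_increasing2)
  qed
next
  case (Suc l)
  define D where "D x y = (\<Sum>h\<in>UNIV. v h * (y $ h - x $ h))" for x y :: "real ^ 'n"
  show ?case
  proof (cases "x \<in> U \<and> y \<in> U")
    case False
    moreover have "stay_prob r p U (Suc l) n w \<le> 1" for w
      using stay_prob_bounds[of U p] p by blast
    moreover have "stay_prob r p U (Suc l) n w = 0" if "w \<notin> U" for w
      using that by (rule stay_prob_outside)
    ultimately have "stay_prob r p U (Suc l) n x + stay_prob r p U (Suc l) n y \<le> 1"
      by (metis add.left_neutral add.right_neutral)
    also have "\<dots> \<le> 1 + exp (\<theta> (n + Suc l) * C) * exp (- (\<theta> n * (\<Sum>h\<in>UNIV. v h * (y $ h - x $ h))))"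
      by simp
    finally show ?thesis .
  next
    case True
    define t where "t = \<theta> (Suc n)"
    define a where "a h = t * r n * v h" for h
    define E where "E = exp (\<theta> (n + Suc l) * C)"
    have a: "0 \<le> a h" "a h \<le> \<eta>" for h
      using \<theta> r v \<theta>_small[OF Suc.prems(1)] by (auto simp: a_def t_def)
    have q: "0 \<le> p y h - p x h" "p y h - p x h \<le> 1" for h
      using mono[of x y h] p[of x h] p[of y h] True Suc.prems(2) by auto
    have D0: "0 \<le> D x y"
      unfolding D_def using v Suc.prems(2) by (intro sum_nonneg mult_nonneg_nonneg) auto
    \<comment> \<open>Ordered innovations keep the successors ordered, so the induction hypothesis
      applies. Their distance, times \<open>t\<close>, is the contracted old distance plus the noise
      with weights \<open>a h\<close>, which the coupling then averages.\<close>
    have "stay_prob r p U l (Suc n) (euler_step (r n) x i) + stay_prob r p U l (Suc n) (euler_step (r n) y i')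
      \<le> 1 + (E * exp (- (t * (1 - r n) * D x y))) * exp (- (\<Sum>h\<in>UNIV. a h * (of_bool (i' h) - of_bool (i h))))"
      if "\<And>h. i h \<le> i' h" for i i'
    proof -
      have "euler_step (r n) x i $ h \<le> euler_step (r n) y i' $ h" for h
        using that[of h] Suc.prems(2)[of h] r[of n]
        unfolding euler_step_def vec_lambda_beta by (intro add_mono mult_left_mono) auto
      then have "stay_prob r p U l (Suc n) (euler_step (r n) x i) + stay_prob r p U l (Suc n) (euler_step (r n) y i')
        \<le> 1 + exp (\<theta> (Suc n + l) * C) * exp (- (t * D (euler_step (r n) x i) (euler_step (r n) y i')))"
        using Suc.IH[of "Suc n"] Suc.prems(1) unfolding t_def D_def by auto
      also have "t * D (euler_step (r n) x i) (euler_step (r n) y i') =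
        t * (1 - r n) * D x y + (\<Sum>h\<in>UNIV. a h * (of_bool (i' h) - of_bool (i h)))"
        unfolding D_def euler_step_def a_def sum_distrib_left sum.distrib[symmetric]
        by (intro sum.cong refl) (simp add: algebra_simps)
      finally show ?thesis by (simp only: minus_add_distrib exp_add E_def add_Suc add_Suc_right mult.assoc)
    qed
    then have "bernoulli_mean (p x) (\<lambda>i. stay_prob r p U l (Suc n) (euler_step (r n) x i)) +
        bernoulli_mean (p y) (\<lambda>i. stay_prob r p U l (Suc n) (euler_step (r n) y i))
      \<le> 1 + (E * exp (- (t * (1 - r n) * D x y))) * (\<Prod>h\<in>UNIV. 1 - (p y h - p x h) * (1 - exp (- a h)))"
      using True p[of x] p[of y] mono[of x y] Suc.prems(2)
      by (intro bernoulli_mean_coupling) (auto simp: E_def)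
    \<comment> \<open>By \<open>1 - s \<le> exp (- s)\<close> the product becomes one exponential
      whose exponent contains the weighted difference of the success probabilities, which
      \<open>drift\<close> bounds from below.\<close>
    also have "(\<Prod>h\<in>UNIV. 1 - (p y h - p x h) * (1 - exp (- a h))) \<le> (\<Prod>h\<in>UNIV. exp (- ((p y h - p x h) * (1 - \<eta>) * a h)))"
    proof (intro prod_mono conjI)
      fix h
      have "(p y h - p x h) * (1 - exp (- a h)) \<le> 1 * 1"
        using q[of h] a(1)[of h] by (intro mult_mono) auto
      then show "0 \<le> 1 - (p y h - p x h) * (1 - exp (- a h))" by simp
      have "(p y h - p x h) * ((1 - \<eta>) * a h) \<le> (p y h - p x h) * (1 - exp (- a h))"
        using q[of h] one_minus_exp_neg_ge[OF a] by (intro mult_left_mono) auto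
      then show "1 - (p y h - p x h) * (1 - exp (- a h)) \<le> exp (- ((p y h - p x h) * (1 - \<eta>) * a h))"
        using exp_ge_add_one_self[of "- ((p y h - p x h) * ((1 - \<eta>) * a h))"] by (simp add: mult.assoc)
    qed
    also have "(\<Prod>h\<in>UNIV. exp (- ((p y h - p x h) * (1 - \<eta>) * a h))) =
        exp (- (t * r n * (1 - \<eta>) * (\<Sum>h\<in>UNIV. v h * (p y h - p x h))))"
      unfolding exp_sum[OF finite_class.finite_UNIV, symmetric] sum_distrib_left sum_negf[symmetric] a_def
      by (intro arg_cong[where f = exp] sum.cong) (auto simp: mult_ac)
    also have "1 + (E * exp (- (t * (1 - r n) * D x y))) * exp (- (t * r n * (1 - \<eta>) * (\<Sum>h\<in>UNIV. v h * (p y h - p x h))))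
      = 1 + E * exp (- (t * (1 - r n) * D x y + t * r n * (1 - \<eta>) * (\<Sum>h\<in>UNIV. v h * (p y h - p x h))))"
      by (simp only: minus_add_distrib exp_add mult.assoc)
    \<comment> \<open>The drift factor \<open>(1 - \<eta>) * (1 + \<mu>) \<ge> 1 + \<kappa>\<close>
      pays for both losses: the \<open>1\<close> compensates the contraction by
      \<open>1 - r n\<close>, and \<open>\<kappa>\<close> the passage from \<open>\<theta> n\<close>
      to \<open>\<theta> (Suc n)\<close>.\<close>
    also have "\<dots> \<le> 1 + E * exp (- (\<theta> n * D x y))"
    proof -
      have "\<theta> n * D x y \<le> t * (1 + \<kappa> * r n) * D x y"
        using \<theta>_decr[OF Suc.prems(1)] D0 unfolding t_def by (intro mult_right_mono)
      also have "\<dots> = t * (1 - r n) * D x y + t * r n * ((1 + \<kappa>) * D x y)"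
        by (simp add: algebra_simps)
      also have "t * r n * ((1 + \<kappa>) * D x y) \<le> t * r n * ((1 - \<eta>) * (\<Sum>h\<in>UNIV. v h * (p y h - p x h)))"
      proof (intro mult_left_mono)
        have "(1 + \<kappa>) * D x y \<le> (1 - \<eta>) * (1 + \<mu>) * D x y"
          using \<eta> D0 by (intro mult_right_mono)
        also have "\<dots> \<le> (1 - \<eta>) * (\<Sum>h\<in>UNIV. v h * (p y h - p x h))"
          using drift[of x y] True Suc.prems(2) \<eta>(1) unfolding mult.assoc D_def by (intro mult_left_mono) auto
        finally show "(1 + \<kappa>) * D x y \<le> (1 - \<eta>) * (\<Sum>h\<in>UNIV. v h * (p y h - p x h))" .
      qed (use \<theta>[of "Suc n"] r[of n] in \<open>auto simp: t_def\<close>)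
      finally show ?thesis by (simp add: E_def mult.assoc)
    qed
    finally show ?thesis using True by (simp add: E_def D_def)
  qed
qed

section \<open>The conditional law of one step\<close>

text \<open>Conditional independence and the conditional marginals determine the conditional law of
  the whole innovation vector. As it has finitely many values, the integral splits over them, and in
  each term the \<open>G\<close>-measurable factor \<open>g\<close> passes through the conditional
  expectation.\<close>

lemma (in prob_space) integral_bernoulli_mean:
  fixes J :: "'n::finite \<Rightarrow> 'a \<Rightarrow> real" and p :: "'a \<Rightarrow> 'n \<Rightarrow> real" and g :: "'a \<Rightarrow> ('n \<Rightarrow> bool) \<Rightarrow> real"
  assumes G: "subalgebra M G"
    and J: "\<And>h \<omega>. \<omega> \<in> space M \<Longrightarrow> J h \<omega> \<in> {0, 1}"
    and indep: "cond_indep_vars M G (\<lambda>_. borel) J UNIV"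
    and prob: "\<And>h. AE \<omega> in M. cond_probability M G {\<omega> \<in> space M. J h \<omega> = 1} \<omega> = p \<omega> h"
    and p: "\<And>h. (\<lambda>\<omega>. p \<omega> h) \<in> borel_measurable M"
    and g: "\<And>i. (\<lambda>\<omega>. g \<omega> i) \<in> borel_measurable G" "\<And>\<omega> i. \<bar>g \<omega> i\<bar> \<le> B"
  shows "(\<integral>\<omega>. g \<omega> (\<lambda>h. J h \<omega> = 1) \<partial>M) = (\<integral>\<omega>. bernoulli_mean (p \<omega>) (g \<omega>) \<partial>M)"
proof -
  interpret finite_measure_subalgebra M G by unfold_locales (rule G)
  have Jm[measurable]: "J h \<in> borel_measurable M" for h
    using indep by (auto simp: cond_indep_vars_def)
  have gM[measurable]: "(\<lambda>\<omega>. g \<omega> i) \<in> borel_measurable M" for i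
    by (rule measurable_from_subalg[OF G g(1)])
  have bounded_int: "integrable M f" if "f \<in> borel_measurable M" "\<And>\<omega>. \<omega> \<in> space M \<Longrightarrow> \<bar>f \<omega>\<bar> \<le> c" for f :: "'a \<Rightarrow> real" and c :: real
    using that by (intro integrable_const_bound[where B = c]) auto
  define Ev where "Ev i h = J h -` {of_bool (i h)} \<inter> space M" for i h
  have Ev[measurable]: "Ev i h \<in> sets M" for i h unfolding Ev_def by measurable
  have single: "AE \<omega> in M. cond_probability M G (Ev i h) \<omega> = (if i h then p \<omega> h else 1 - p \<omega> h)" for i h
  proof (cases "i h")
    case True
    have "Ev i h = {\<omega> \<in> space M. J h \<omega> = 1}" using True by (auto simp: Ev_def)
    then show ?thesis using True prob[of h] by simp
  next
    case False
    let ?A = "{\<omega> \<in> space M. J h \<omega> = 1}"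
    have A: "indicator (Ev i h) \<omega> = 1 - (indicator ?A \<omega> :: real)" if "\<omega> \<in> space M" for \<omega>
      using J[OF that, of h] that False by (auto simp: Ev_def indicator_def)
    have "AE \<omega> in M. real_cond_exp M G (indicator (Ev i h)) \<omega> = real_cond_exp M G (\<lambda>\<omega>. 1 - indicator ?A \<omega>) \<omega>"
      by (intro real_cond_exp_cong AE_I2 A) measurable
    moreover have "AE \<omega> in M. real_cond_exp M G (\<lambda>\<omega>. 1 - indicator ?A \<omega>) \<omega> =
        real_cond_exp M G (\<lambda>_. 1) \<omega> - real_cond_exp M G (indicator ?A) \<omega>"
      by (intro real_cond_exp_diff bounded_int[of _ 1]) (auto simp: indicator_def)
    moreover have "AE \<omega> in M. real_cond_exp M G (\<lambda>_. 1) \<omega> = 1"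
      by (intro real_cond_exp_F_meas) auto
    ultimately show ?thesis
      using prob[of h] unfolding cond_probability_def by eventually_elim (use False in auto)
  qed
  define W where "W i \<omega> = (\<Prod>h\<in>UNIV. if i h then p \<omega> h else 1 - p \<omega> h)" for i \<omega>
  have W: "AE \<omega> in M. cond_probability M G (\<Inter>h\<in>UNIV. Ev i h) \<omega> = W i \<omega>" for i
  proof -
    have "AE \<omega> in M. cond_probability M G (\<Inter>h\<in>UNIV. Ev i h) \<omega> = (\<Prod>h\<in>UNIV. cond_probability M G (Ev i h) \<omega>)"
      using indep[unfolded cond_indep_vars_def, THEN conjunct2, rule_format, of UNIV "\<lambda>h. {of_bool (i h)}"]
      by (auto simp: Ev_def)
    moreover have "AE \<omega> in M. \<forall>h\<in>UNIV. cond_probability M G (Ev i h) \<omega> = (if i h then p \<omega> h else 1 - p \<omega> h)"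
      using single by (subst AE_finite_all) auto
    ultimately show ?thesis by eventually_elim (auto simp: W_def)
  qed
  have Wm[measurable]: "W i \<in> borel_measurable M" for i
    unfolding W_def using p by measurable
  have gi: "integrable M (\<lambda>\<omega>. g \<omega> i * indicator (\<Inter>h\<in>UNIV. Ev i h) \<omega>)" for i
    using g(2) order_trans[OF abs_ge_zero g(2)] by (intro bounded_int[of _ B]) (auto simp: indicator_def)
  have step: "integrable M (\<lambda>\<omega>. g \<omega> i * W i \<omega>) \<and>
    (\<integral>\<omega>. g \<omega> i * indicator (\<Inter>h\<in>UNIV. Ev i h) \<omega> \<partial>M) = (\<integral>\<omega>. g \<omega> i * W i \<omega> \<partial>M)" for i
  proof -
    note 1 = real_cond_exp_intg[OF gi g(1)]
    have ae: "AE \<omega> in M. g \<omega> i * real_cond_exp M G (indicator (\<Inter>h\<in>UNIV. Ev i h)) \<omega> = g \<omega> i * W i \<omega>"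
      using W[of i] unfolding cond_probability_def by eventually_elim simp
    show ?thesis
      using 1 integrable_cong_AE[OF _ _ ae] integral_cong_AE[OF _ _ ae] by auto
  qed
  \<comment> \<open>For each outcome exactly one Boolean vector \<open>i\<close> agrees with the
    innovations in all coordinates, so the sum has a single nonzero indicator.\<close>
  have "g \<omega> (\<lambda>h. J h \<omega> = 1) = (\<Sum>i\<in>UNIV. g \<omega> i * indicator (\<Inter>h\<in>UNIV. Ev i h) \<omega>)" if "\<omega> \<in> space M" for \<omega>
  proof -
    have "\<omega> \<in> (\<Inter>h\<in>UNIV. Ev i h) \<longleftrightarrow> i = (\<lambda>h. J h \<omega> = 1)" for i
    proof -
      have "J h \<omega> = of_bool (i h) \<longleftrightarrow> i h = (J h \<omega> = 1)" for h
        using J[OF that, of h] by auto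
      then show ?thesis using that by (auto simp: Ev_def fun_eq_iff)
    qed
    then have "(\<Sum>i\<in>UNIV. g \<omega> i * indicator (\<Inter>h\<in>UNIV. Ev i h) \<omega>) = (\<Sum>i\<in>UNIV. if i = (\<lambda>h. J h \<omega> = 1) then g \<omega> i else 0)"
      by (intro sum.cong) (auto simp: indicator_def)
    then show ?thesis by simp
  qed
  then have "(\<integral>\<omega>. g \<omega> (\<lambda>h. J h \<omega> = 1) \<partial>M) = (\<integral>\<omega>. (\<Sum>i\<in>UNIV. g \<omega> i * indicator (\<Inter>h\<in>UNIV. Ev i h) \<omega>) \<partial>M)"
    by (intro Bochner_Integration.integral_cong) auto
  also have "\<dots> = (\<Sum>i\<in>UNIV. \<integral>\<omega>. g \<omega> i * indicator (\<Inter>h\<in>UNIV. Ev i h) \<omega> \<partial>M)"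
    using gi by (intro Bochner_Integration.integral_sum) auto
  also have "\<dots> = (\<Sum>i\<in>UNIV. \<integral>\<omega>. g \<omega> i * W i \<omega> \<partial>M)"
    using step by auto
  also have "\<dots> = (\<integral>\<omega>. (\<Sum>i\<in>UNIV. g \<omega> i * W i \<omega>) \<partial>M)"
    using step by (intro Bochner_Integration.integral_sum[symmetric]) auto
  finally show ?thesis by (simp add: bernoulli_mean_def W_def mult.commute)
qed

section \<open>Uniform bound on the probability of staying\<close>

lemma sum_step_sizes_at_top:
  fixes r :: "nat \<Rightarrow> real"
  assumes "1 \<le> a" "\<And>i. a \<le> i \<Longrightarrow> 1 / 2 \<le> real i * r i"
  shows "filterlim (\<lambda>j. \<Sum>i=a..<j. r i) at_top sequentially"
proof -
  \<comment> \<open>Each \<open>r j\<close> is at least \<open>1 / (2 * j)\<close>, hence at least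
    half the increment of \<open>ln\<close> from \<open>j\<close> to \<open>j + 1\<close>; these
    increments telescope.\<close>
  have "(ln (real j) - ln (real a)) / 2 \<le> (\<Sum>i=a..<j. r i)" if "a \<le> j" for j
    using that
  proof (induction j rule: dec_induct)
    case (step j)
    have j: "0 < real j" using step assms by auto
    have "ln (real (Suc j)) = ln (real j * (1 + 1 / real j))"
      using j by (simp add: distrib_left)
    also have "\<dots> = ln (real j) + ln (1 + 1 / real j)"
      using j by (intro ln_mult_pos) (auto intro: add_pos_nonneg)
    also have "ln (1 + 1 / real j) \<le> 1 / real j"
      using j by (intro ln_add_one_self_le_self) auto
    finally have "ln (real (Suc j)) \<le> ln (real j) + 1 / real j" by simp
    moreover have "1 / real j \<le> 2 * r j"
      using assms(2)[of j] step j by (simp add: field_simps)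
    ultimately show ?case using step by (simp add: field_simps)
  qed simp
  moreover have "filterlim (\<lambda>j. (ln (real j) - ln (real a)) / 2) at_top sequentially"
    by real_asymp
  ultimately show ?thesis
    by (elim filterlim_at_top_mono) (auto simp: eventually_sequentially)
qed

text \<open>
  Flipping one coordinate at time \<open>n\<close> gives two ordered successors at distance of order \<open>1 / n\<close>,
  which stay in \<open>U\<close> together with probability bounded away from \<open>1\<close>.
\<close>

lemma stay_prob_uniform_bound:
  fixes v :: "'n::finite \<Rightarrow> real" and p :: "real ^ 'n \<Rightarrow> 'n \<Rightarrow> real"
  assumes c: "0 < c" "\<And>x h. x \<in> U \<Longrightarrow> c \<le> p x h \<and> p x h \<le> 1 - c"
    and mono: "\<And>x y h. x \<in> U \<Longrightarrow> y \<in> U \<Longrightarrow> (\<And>h. x $ h \<le> y $ h) \<Longrightarrow> p x h \<le> p y h"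
    and \<mu>: "0 < \<mu>" and drift: "\<And>x y. x \<in> U \<Longrightarrow> y \<in> U \<Longrightarrow> (\<And>h. x $ h \<le> y $ h) \<Longrightarrow>
      (1 + \<mu>) * (\<Sum>h\<in>UNIV. v h * (y $ h - x $ h)) \<le> (\<Sum>h\<in>UNIV. v h * (p y h - p x h))"
    and diam: "\<And>x y. x \<in> U \<Longrightarrow> y \<in> U \<Longrightarrow> (\<Sum>h\<in>UNIV. v h * (y $ h - x $ h)) \<le> C"
    and v: "\<And>h. 0 \<le> v h" "0 < v k"
    and r: "\<And>n. 0 \<le> r n \<and> r n \<le> 1" "(\<lambda>n. real n * r n) \<longlonglongrightarrow> 1"
  shows "\<exists>\<rho><1. \<exists>N. \<forall>n\<ge>N. \<exists>e. e \<longlonglongrightarrow> 0 \<and> (\<forall>l. \<forall>x\<in>U. stay_prob r p U (Suc l) n x \<le> \<rho> + e l)"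
proof -
  have p01: "0 \<le> p x h \<and> p x h \<le> 1" if "x \<in> U" for x h
    using c(1) c(2)[OF that, of h] by auto
  have "\<forall>\<^sub>F n in sequentially. 1 / 2 < real n * r n" "\<forall>\<^sub>F n in sequentially. real n * r n < 2"
    by (rule order_tendstoD[OF r(2)]; simp)+
  then have "\<forall>\<^sub>F n in sequentially. 1 / 2 \<le> real n * r n \<and> real n * r n \<le> 2"
    by eventually_elim auto
  then obtain N0 where N0: "\<And>n. N0 \<le> n \<Longrightarrow> 1 / 2 \<le> real n * r n \<and> real n * r n \<le> 2"
    by (auto simp: eventually_sequentially)
  define N where "N = max 1 N0"
  \<comment> \<open>\<open>\<eta>\<close> solves
    \<open>(1 - \<eta>) * (1 + \<mu>) = 1 + \<kappa>\<close>. \<open>b\<close> is chosen so that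
    \<open>2 * b * B = \<eta>\<close>, which suffices for \<open>\<theta>_small\<close> since
    \<open>n * r j \<le> 2\<close> for later \<open>j\<close>. \<open>\<delta>\<close> comes from
    \<open>n * r n \<ge> 1 / 2\<close> and does not depend on \<open>n\<close>.\<close>
  define \<kappa> where "\<kappa> = \<mu> / 2"
  define \<eta> where "\<eta> = \<kappa> / (1 + \<mu>)"
  define B where "B = (\<Sum>h\<in>UNIV. v h)"
  define b where "b = \<eta> / (2 * B)"
  define \<delta> where "\<delta> = exp (- (b * v k / 2))"
  have \<eta>: "0 < \<eta>" "\<eta> \<le> 1" "1 + \<kappa> \<le> (1 - \<eta>) * (1 + \<mu>)"
    using \<mu> by (auto simp: \<eta>_def \<kappa>_def field_simps)
  have vB: "v h \<le> B" for h unfolding B_def using v by (intro member_le_sum) auto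
  have B: "0 < B" using v(2) vB[of k] by linarith
  have b: "0 < b" using \<eta> B by (simp add: b_def)
  have \<kappa>: "0 < \<kappa>" using \<mu> by (simp add: \<kappa>_def)
  have \<delta>: "\<delta> < 1" using b v(2) by (simp add: \<delta>_def)
  have main: "\<exists>e. e \<longlonglongrightarrow> 0 \<and> (\<forall>l. \<forall>x\<in>U. stay_prob r p U (Suc l) n x \<le> 1 - c * (1 - \<delta>) + e l)"
    if n: "N \<le> n" for n
  proof -
    \<comment> \<open>At \<open>Suc n\<close> the sum is empty and \<open>\<theta>\<close> equals
      \<open>b * n\<close>, which matches a separation of order \<open>1 / n\<close>. Afterwards it
      decreases slowly enough for \<open>\<theta>_decr\<close>, yet tends to \<open>0\<close>
      because the step sizes have infinite sum, so \<open>exp (\<theta> * C)\<close> tends to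
      \<open>1\<close>.\<close>
    define \<theta> where "\<theta> j = b * real n / (1 + \<kappa> * (\<Sum>i=Suc n..<j. r i))" for j
    have n1: "1 \<le> n" and rn: "\<And>j. n \<le> j \<Longrightarrow> 1 / 2 \<le> real j * r j \<and> real j * r j \<le> 2"
      using n N0 by (auto simp: N_def)
    have S: "0 \<le> \<kappa> * (\<Sum>i=Suc n..<j. r i)" for j
      using \<kappa> r by (simp add: sum_nonneg)
    have \<theta>0: "0 \<le> \<theta> j" for j
      using S[of j] b n1 by (auto simp: \<theta>_def)
    have \<theta>_le: "\<theta> j \<le> b * real n" for j
    proof -
      have "b * real n / (1 + \<kappa> * (\<Sum>i=Suc n..<j. r i)) \<le> b * real n / 1"
        using S[of j] b by (intro divide_left_mono) auto
      then show ?thesis by (simp add: \<theta>_def)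
    qed
    have \<theta>_small: "\<theta> (Suc j) * r j * v h \<le> \<eta>" if "Suc n \<le> j" for j h
    proof -
      have "real n * r j \<le> real j * r j" using that r by (intro mult_right_mono) auto
      then have nr: "real n * r j \<le> 2" using rn[of j] that by linarith
      have "\<theta> (Suc j) * r j * v h \<le> (b * real n) * r j * B"
        using \<theta>_le[of "Suc j"] \<theta>0[of "Suc j"] r(1)[of j] v vB b by (intro mult_mono) auto
      also have "\<dots> = b * B * (real n * r j)" by simp
      also have "\<dots> \<le> b * B * 2" using nr b B by (intro mult_left_mono) auto
      also have "\<dots> = \<eta>" using B by (simp add: b_def)
      finally show ?thesis .
    qed
    have \<theta>_decr: "\<theta> j \<le> \<theta> (Suc j) * (1 + \<kappa> * r j)" if "Suc n \<le> j" for j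
    proof -
      define s where "s = \<kappa> * (\<Sum>i=Suc n..<j. r i)"
      have s: "\<kappa> * (\<Sum>i=Suc n..<Suc j. r i) = s + \<kappa> * r j"
        using that by (simp add: s_def algebra_simps)
      have "0 \<le> s" "0 \<le> \<kappa> * r j" using S \<kappa> r by (auto simp: s_def)
      then have "1 + s + \<kappa> * r j \<le> (1 + s) * (1 + \<kappa> * r j)"
        using mult_nonneg_nonneg[of s "\<kappa> * r j"] by (simp add: algebra_simps)
      then have "1 / (1 + s) \<le> (1 + \<kappa> * r j) / (1 + (s + \<kappa> * r j))"
        using \<open>0 \<le> s\<close> \<open>0 \<le> \<kappa> * r j\<close> by (simp add: divide_simps mult.commute)
      then have "b * real n * (1 / (1 + s)) \<le> b * real n * ((1 + \<kappa> * r j) / (1 + (s + \<kappa> * r j)))"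
        using b by (intro mult_left_mono) auto
      then show ?thesis unfolding \<theta>_def s unfolding s_def[symmetric] by simp
    qed
    have \<theta>_lim: "\<theta> \<longlonglongrightarrow> 0"
    proof -
      have "filterlim (\<lambda>j. \<Sum>i=Suc n..<j. r i) at_top sequentially"
        using rn by (intro sum_step_sizes_at_top) auto
      then have "filterlim (\<lambda>j. 1 + \<kappa> * (\<Sum>i=Suc n..<j. r i)) at_top sequentially"
        by (intro filterlim_tendsto_add_at_top[OF tendsto_const]
            filterlim_tendsto_pos_mult_at_top[OF tendsto_const \<kappa>])
      then show ?thesis
        unfolding \<theta>_def
        by (intro real_tendsto_divide_at_top[OF tendsto_const]) 
    qed
    \<comment> \<open>This is the error made by replacing the prefactor \<open>K\<close> below by
      its limit \<open>1\<close>. It may depend on \<open>n\<close>: only the bound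
      \<open>1 - c * (1 - \<delta>)\<close> has to be uniform.\<close>
    define e where "e l = c * \<delta> * (exp (\<theta> (Suc n + l) * C) - 1)" for l
    have "(\<lambda>l. \<theta> (Suc n + l)) \<longlonglongrightarrow> 0"
      using \<theta>_lim by (simp only: add.commute[of "Suc n"]) (rule LIMSEQ_ignore_initial_segment)
    then have "(\<lambda>l. c * \<delta> * (exp (\<theta> (Suc n + l) * C) - 1)) \<longlonglongrightarrow> c * \<delta> * (exp (0 * C) - 1)"
      by (intro tendsto_intros)
    then have e: "e \<longlonglongrightarrow> 0" by (simp add: e_def[abs_def])
    have "stay_prob r p U (Suc l) n x \<le> 1 - c * (1 - \<delta>) + e l" if x: "x \<in> U" for l x
    proof -
      define G where "G i = stay_prob r p U l (Suc n) (euler_step (r n) x i)" for i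
      define K where "K = exp (\<theta> (Suc n + l) * C)"
      have flip: "G (i(k := False)) + G (i(k := True)) \<le> 1 + K * \<delta>" for i
      proof -
        let ?y = "euler_step (r n) x (i(k := False))" and ?y' = "euler_step (r n) x (i(k := True))"
        have le: "?y $ h \<le> ?y' $ h" for h using r(1)[of n] by (auto simp: euler_step_def)
        \<comment> \<open>The successors differ only in coordinate \<open>k\<close>, by
          \<open>r n\<close>; the positive weight \<open>v k\<close> makes this visible in the
          weighted distance.\<close>
        have "(\<Sum>h\<in>UNIV. v h * (?y' $ h - ?y $ h)) = (\<Sum>h\<in>UNIV. if h = k then r n * v k else 0)"
          by (intro sum.cong) (auto simp: euler_step_def)
        then have D: "(\<Sum>h\<in>UNIV. v h * (?y' $ h - ?y $ h)) = r n * v k" by simp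
        have "G (i(k := False)) + G (i(k := True)) \<le> 1 + K * exp (- (\<theta> (Suc n) * (r n * v k)))"
          unfolding G_def K_def D[symmetric]
          by (rule stay_prob_pair[where U = U and p = p and v = v and r = r and \<theta> = \<theta> and m = "Suc n", OF p01 mono drift diam v(1) r(1) \<theta>0 \<theta>_small \<theta>_decr \<eta>(2,3) order_refl le])
        also have "exp (- (\<theta> (Suc n) * (r n * v k))) \<le> \<delta>"
        proof -
          have "b * v k * (1 / 2) \<le> b * v k * (real n * r n)"
            using rn[of n] b v(2) by (intro mult_left_mono) auto
          then show ?thesis by (simp add: \<delta>_def \<theta>_def mult_ac)
        qed
        finally show ?thesis by (simp add: K_def)
      qed
      have "G i \<le> 1" for i
        unfolding G_def using stay_prob_bounds[of U p] p01 by blast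
      then have "bernoulli_mean (p x) G \<le> 1 - c * (1 - K * \<delta>)"
        using bernoulli_mean_flip[of "p x" c k G "K * \<delta>"] flip p01[OF x] c(1) c(2)[OF x] by auto
      then show ?thesis
        using x by (simp add: G_def[abs_def] e_def K_def algebra_simps)
    qed
    then show ?thesis using e by blast
  qed
  have "1 - c * (1 - \<delta>) < 1" using c(1) \<delta> by simp
  then show ?thesis using main by blast
qed

section \<open>Chains of conditionally independent Bernoulli innovations\<close>

text \<open>The success probability is a Borel function on the whole space; bounds, monotonicity and
  drift are imposed later, on the set \<open>U\<close> alone.\<close>

locale bernoulli_chain = prob_space M
  for M :: "'a measure" +
  fixes Z :: "nat \<Rightarrow> 'a \<Rightarrow> real ^ 'n" and I :: "nat \<Rightarrow> 'n \<Rightarrow> 'a \<Rightarrow> real"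
    and r :: "nat \<Rightarrow> real" and p :: "real ^ 'n \<Rightarrow> 'n \<Rightarrow> real"
  assumes Z0_measurable: "\<And>h. (\<lambda>\<omega>. Z 0 \<omega> $ h) \<in> borel_measurable M"
    and I_measurable: "\<And>n h. I (Suc n) h \<in> borel_measurable M"
    and I_values: "\<And>n h \<omega>. \<omega> \<in> space M \<Longrightarrow> I (Suc n) h \<omega> \<in> {0, 1}"
    and Z_Suc: "\<And>n h \<omega>. \<omega> \<in> space M \<Longrightarrow> Z (Suc n) \<omega> $ h = (1 - r n) * Z n \<omega> $ h + r n * I (Suc n) h \<omega>"
    and indep: "\<And>n. cond_indep_vars M (history M Z I n) (\<lambda>_. borel) (I (Suc n)) UNIV"
    and cond_prob: "\<And>n h. AE \<omega> in M.
      cond_probability M (history M Z I n) {\<omega> \<in> space M. I (Suc n) h \<omega> = 1} \<omega> = p (Z n \<omega>) h"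
    and p_measurable: "\<And>h. (\<lambda>x. p x h) \<in> borel_measurable borel"
begin

lemma space_history: "space (history M Z I n) = space M"
  unfolding history_def by (rule space_measure_of) auto

lemma sets_history:
  "sets (history M Z I n) = sigma_sets (space M)
     ({(\<lambda>\<omega>. Z 0 \<omega> $ h) -` A \<inter> space M | h A. A \<in> sets borel} \<union>
      {I k h -` A \<inter> space M | k h A. k \<in> {1..n} \<and> A \<in> sets borel})"
  unfolding history_def by (rule sets_measure_of) auto

lemma subalgebra_history: "subalgebra M (history M Z I n)"
proof -
  have "I k h -` A \<inter> space M \<in> sets M" if "1 \<le> k" "A \<in> sets borel" for k h A
    using measurable_sets[OF I_measurable[of "k - 1" h] that(2)] that(1) by simp
  then show ?thesis
    unfolding subalgebra_def space_history sets_history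
    using measurable_sets[OF Z0_measurable] by (auto intro!: sets.sigma_sets_subset)
qed

lemma subalgebra_history_mono: "m \<le> n \<Longrightarrow> subalgebra (history M Z I n) (history M Z I m)"
proof -
  assume "m \<le> n"
  then have "{1..m} \<subseteq> {1..n}" by auto
  then show ?thesis
    unfolding subalgebra_def space_history sets_history
    by (intro conjI refl sigma_sets_mono' Un_mono subset_refl) blast
qed

lemma Z0_measurable_history: "(\<lambda>\<omega>. Z 0 \<omega> $ h) \<in> borel_measurable (history M Z I n)"
  by (rule measurableI) (auto simp: sets_history space_history intro!: sigma_sets.Basic)

lemma I_measurable_history: "k < n \<Longrightarrow> I (Suc k) h \<in> borel_measurable (history M Z I n)"
proof (rule measurableI)
  fix A :: "real set"
  assume "k < n" "A \<in> sets borel"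
  moreover from this have "Suc k \<in> {1..n}" by auto
  ultimately show "I (Suc k) h -` A \<inter> space (history M Z I n) \<in> sets (history M Z I n)"
    unfolding sets_history space_history by (intro sigma_sets.Basic UnI2) blast
qed simp

lemma Z_component_measurable_history: "m \<le> n \<Longrightarrow> (\<lambda>\<omega>. Z m \<omega> $ h) \<in> borel_measurable (history M Z I n)"
proof (induction m)
  case (Suc m)
  have "(\<lambda>\<omega>. (1 - r m) * Z m \<omega> $ h + r m * I (Suc m) h \<omega>) \<in> borel_measurable (history M Z I n)"
    using Suc I_measurable_history[of m n h] by auto
  then show ?case
    by (rule measurable_cong[THEN iffD1, rotated]) (simp add: space_history Z_Suc)
qed (rule Z0_measurable_history)

lemma Z_measurable_history: "m \<le> n \<Longrightarrow> Z m \<in> borel_measurable (history M Z I n)"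
  using Z_component_measurable_history[of m n]
  by (subst borel_measurable_euclidean_space) (auto simp: Basis_vec_def inner_axis)

lemma Z_measurable: "Z n \<in> borel_measurable M"
  using Z_measurable_history[of n n] measurable_from_subalg[OF subalgebra_history] by blast

lemma Z_Suc_eq_euler_step:
  "\<omega> \<in> space M \<Longrightarrow> Z (Suc n) \<omega> = euler_step (r n) (Z n \<omega>) (\<lambda>h. I (Suc n) h \<omega> = 1)"
  using I_values[of \<omega> n] by (auto simp: vec_eq_iff euler_step_def Z_Suc)

lemma euler_step_measurable: "(\<lambda>x. euler_step \<rho> x i) \<in> borel_measurable borel"
  unfolding euler_step_def
  by (intro borel_measurable_continuous_onI continuous_intros)

lemma stay_prob_measurable:
  assumes "U \<in> sets borel"
  shows "stay_prob r p U l n \<in> borel_measurable borel"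
proof (induction l arbitrary: n)
  case 0
  then show ?case using assms by (simp add: stay_prob.simps(1)[abs_def])
next
  case (Suc l)
  have [measurable]: "(\<lambda>x. stay_prob r p U l (Suc n) (euler_step (r n) x i)) \<in> borel_measurable borel" for i
    by (rule measurable_compose[OF euler_step_measurable Suc])
  note [measurable] = p_measurable assms
  show ?case
    unfolding stay_prob.simps(2)[abs_def] bernoulli_mean_def by measurable
qed

definition stays :: "(real ^ 'n) set \<Rightarrow> nat \<Rightarrow> nat \<Rightarrow> 'a set" where
  "stays U m n = {\<omega> \<in> space M. \<forall>j\<in>{m..n}. Z j \<omega> \<in> U}"

lemma stays_sets_history:
  assumes "U \<in> sets borel"
  shows "stays U m n \<in> sets (history M Z I n)"
proof -
  have "stays U m n = {\<omega> \<in> space (history M Z I n). \<forall>j\<in>{m..n}. Z j \<omega> \<in> U}"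
    by (simp add: stays_def space_history)
  also have "\<dots> \<in> sets (history M Z I n)"
  proof (cases "m \<le> n")
    case True
    have "{\<omega> \<in> space (history M Z I n). Z j \<omega> \<in> U} \<in> sets (history M Z I n)" if "j \<in> {m..n}" for j
      using measurable_sets[OF Z_measurable_history assms, of j n] that
      by (simp add: vimage_def Int_def conj_commute)
    then show ?thesis using True by (intro sets.sets_Collect_finite_All') auto
  qed simp
  finally show ?thesis .
qed

lemma stays_sets: "U \<in> sets borel \<Longrightarrow> stays U m n \<in> sets M"
  using stays_sets_history[of U m n] subalgebra_history[of n] by (auto simp: subalgebra_def)

text \<open>This is the Markov property, by induction on \<open>l\<close> with \<open>n\<close>
  arbitrary. The event up to time \<open>n\<close> and the state \<open>Z n\<close> are known to the
  history, so \<open>integral_bernoulli_mean\<close> averages out the innovations of time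
  \<open>Suc n\<close>.\<close>

lemma prob_stays_eq_integral_stay_prob:
  assumes U: "U \<in> sets borel" and p: "\<And>x h. x \<in> U \<Longrightarrow> 0 \<le> p x h \<and> p x h \<le> 1" and "m \<le> n"
  shows "prob (stays U m (n + l)) = (\<integral>\<omega>. indicator (stays U m n) \<omega> * stay_prob r p U l n (Z n \<omega>) \<partial>M)"
  using \<open>m \<le> n\<close>
proof (induction l arbitrary: n)
  case 0
  have "(\<integral>\<omega>. indicator (stays U m n) \<omega> * stay_prob r p U 0 n (Z n \<omega>) \<partial>M) = (\<integral>\<omega>. indicator (stays U m n) \<omega> \<partial>M)"
    using 0 by (intro Bochner_Integration.integral_cong) (auto simp: stays_def indicator_def)
  then show ?case using stays_sets[OF U] by simp
next
  case (Suc l)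
  define g where "g \<omega> i = indicator (stays U m n) \<omega> * stay_prob r p U l (Suc n) (euler_step (r n) (Z n \<omega>) i)" for \<omega> i
  have g: "(\<lambda>\<omega>. g \<omega> i) \<in> borel_measurable (history M Z I n)" for i
    unfolding g_def using stays_sets_history[OF U]
    by (intro borel_measurable_times borel_measurable_indicator
        measurable_compose[OF Z_measurable_history measurable_compose[OF euler_step_measurable stay_prob_measurable[OF U]]]) auto
  have g1: "\<bar>g \<omega> i\<bar> \<le> 1" for \<omega> i
  proof -
    have "0 \<le> stay_prob r p U l (Suc n) (euler_step (r n) (Z n \<omega>) i) \<and> stay_prob r p U l (Suc n) (euler_step (r n) (Z n \<omega>) i) \<le> 1"
      using stay_prob_bounds[of U p] p by blast
    then show ?thesis by (auto simp: g_def indicator_def)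
  qed
  have "prob (stays U m (n + Suc l)) = (\<integral>\<omega>. indicator (stays U m (Suc n)) \<omega> * stay_prob r p U l (Suc n) (Z (Suc n) \<omega>) \<partial>M)"
    using Suc.IH[of "Suc n"] Suc.prems by simp
  also have "\<dots> = (\<integral>\<omega>. g \<omega> (\<lambda>h. I (Suc n) h \<omega> = 1) \<partial>M)"
  proof (intro Bochner_Integration.integral_cong refl)
    fix \<omega> assume \<omega>: "\<omega> \<in> space M"
    have "\<omega> \<in> stays U m (Suc n) \<longleftrightarrow> \<omega> \<in> stays U m n \<and> Z (Suc n) \<omega> \<in> U"
      using Suc.prems by (auto simp: stays_def le_Suc_eq)
    then show "indicator (stays U m (Suc n)) \<omega> * stay_prob r p U l (Suc n) (Z (Suc n) \<omega>) = g \<omega> (\<lambda>h. I (Suc n) h \<omega> = 1)"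
      unfolding g_def Z_Suc_eq_euler_step[OF \<omega>, symmetric]
      by (auto simp: indicator_def stay_prob_outside)
  qed
  also have "\<dots> = (\<integral>\<omega>. bernoulli_mean (p (Z n \<omega>)) (g \<omega>) \<partial>M)"
    by (rule integral_bernoulli_mean[OF subalgebra_history I_values indep cond_prob
          measurable_compose[OF Z_measurable p_measurable] g g1])
  also have "\<dots> = (\<integral>\<omega>. indicator (stays U m n) \<omega> * stay_prob r p U (Suc l) n (Z n \<omega>) \<partial>M)"
    using Suc.prems
    by (intro Bochner_Integration.integral_cong)
      (auto simp: g_def stays_def indicator_def bernoulli_mean_def)
  finally show ?case .
qed

text \<open>Let \<open>S\<close> be the event of staying in \<open>U\<close> from time
  \<open>m\<close> on. Conditioning at a late time \<open>n\<close> gives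
  \<open>prob S \<le> \<rho> * prob (stays U m n)\<close>; as \<open>n\<close> grows the right side
  tends to \<open>\<rho> * prob S\<close>, and \<open>\<rho> < 1\<close> forces
  \<open>prob S = 0\<close>.\<close>

theorem prob_stays_forever_eq_0:
  fixes v :: "'n \<Rightarrow> real"
  assumes U: "U \<in> sets borel"
    and c: "0 < c" "\<And>x h. x \<in> U \<Longrightarrow> c \<le> p x h \<and> p x h \<le> 1 - c"
    and mono: "\<And>x y h. x \<in> U \<Longrightarrow> y \<in> U \<Longrightarrow> (\<And>h. x $ h \<le> y $ h) \<Longrightarrow> p x h \<le> p y h"
    and \<mu>: "0 < \<mu>" and drift: "\<And>x y. x \<in> U \<Longrightarrow> y \<in> U \<Longrightarrow> (\<And>h. x $ h \<le> y $ h) \<Longrightarrow>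
      (1 + \<mu>) * (\<Sum>h\<in>UNIV. v h * (y $ h - x $ h)) \<le> (\<Sum>h\<in>UNIV. v h * (p y h - p x h))"
    and diam: "\<And>x y. x \<in> U \<Longrightarrow> y \<in> U \<Longrightarrow> (\<Sum>h\<in>UNIV. v h * (y $ h - x $ h)) \<le> C"
    and v: "\<And>h. 0 \<le> v h" "0 < v k"
    and r: "\<And>n. 0 \<le> r n \<and> r n \<le> 1" "(\<lambda>n. real n * r n) \<longlonglongrightarrow> 1"
  shows "{\<omega> \<in> space M. \<forall>n\<ge>m. Z n \<omega> \<in> U} \<in> null_sets M"
proof -
  define S where "S = (\<Inter>n. stays U m n)"
  have S_eq: "{\<omega> \<in> space M. \<forall>n\<ge>m. Z n \<omega> \<in> U} = S"
    unfolding S_def stays_def by fastforce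
  have S: "S \<in> sets M" unfolding S_def using stays_sets[OF U] by auto
  have le: "prob S \<le> prob (stays U m n)" for n
    unfolding S_def using stays_sets[OF U] by (intro finite_measure_mono) auto
  have p01: "0 \<le> p x h \<and> p x h \<le> 1" if "x \<in> U" for x h
    using c(1) c(2)[OF that, of h] by auto
  obtain \<rho> N where "\<rho> < 1"
    and N: "\<And>n. N \<le> n \<Longrightarrow> \<exists>e. e \<longlonglongrightarrow> 0 \<and> (\<forall>l. \<forall>x\<in>U. stay_prob r p U (Suc l) n x \<le> \<rho> + e l)"
    using stay_prob_uniform_bound[where U = U and p = p and v = v and r = r and k = k, OF c mono \<mu> drift diam v r] by blast
  have "prob S \<le> \<rho> * prob (stays U m n)" if n: "max m N \<le> n" for n
  proof -
    obtain e where e: "e \<longlonglongrightarrow> 0" "\<And>l x. x \<in> U \<Longrightarrow> stay_prob r p U (Suc l) n x \<le> \<rho> + e l"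
      using N[of n] n by auto
    have "prob S \<le> (\<rho> + e l) * prob (stays U m n)" for l
    proof -
      have [measurable]: "stays U m n \<in> sets M" by (rule stays_sets[OF U])
      have [measurable]: "(\<lambda>\<omega>. stay_prob r p U (Suc l) n (Z n \<omega>)) \<in> borel_measurable M"
        by (rule measurable_compose[OF Z_measurable stay_prob_measurable[OF U]])
      have b: "0 \<le> stay_prob r p U (Suc l) n x \<and> stay_prob r p U (Suc l) n x \<le> 1" for x
        using stay_prob_bounds[of U p] p01 by blast
      have "prob S \<le> prob (stays U m (n + Suc l))" by (rule le)
      also have "\<dots> = (\<integral>\<omega>. indicator (stays U m n) \<omega> * stay_prob r p U (Suc l) n (Z n \<omega>) \<partial>M)"
        using n by (intro prob_stays_eq_integral_stay_prob[OF U p01]) auto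
      also have "\<dots> \<le> (\<integral>\<omega>. indicator (stays U m n) \<omega> * (\<rho> + e l) \<partial>M)"
      proof (rule integral_mono)
        show "integrable M (\<lambda>\<omega>. indicator (stays U m n) \<omega> * stay_prob r p U (Suc l) n (Z n \<omega>))"
          using b by (intro integrable_const_bound[where B = 1]) (auto simp: indicator_def abs_mult simp del: stay_prob.simps)
        show "integrable M (\<lambda>\<omega>. indicator (stays U m n) \<omega> * (\<rho> + e l))"
          by (intro integrable_const_bound[where B = "\<bar>\<rho> + e l\<bar>"]) (auto simp: indicator_def)
        show "indicator (stays U m n) \<omega> * stay_prob r p U (Suc l) n (Z n \<omega>) \<le> indicator (stays U m n) \<omega> * (\<rho> + e l)" for \<omega>
          using e(2)[of "Z n \<omega>" l] n by (auto simp: indicator_def stays_def simp del: stay_prob.simps)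
      qed
      finally show ?thesis by (simp add: mult.commute)
    qed
    \<comment> \<open>The limit in \<open>l\<close> is taken first, with \<open>n\<close> fixed,
      because \<open>e\<close> depends on \<open>n\<close>.\<close>
    moreover have "(\<lambda>l. (\<rho> + e l) * prob (stays U m n)) \<longlonglongrightarrow> (\<rho> + 0) * prob (stays U m n)"
      by (intro tendsto_intros e(1))
    ultimately show ?thesis by (intro LIMSEQ_le_const[where X = "\<lambda>l. (\<rho> + e l) * prob (stays U m n)"]) auto
  qed
  moreover have "(\<lambda>n. \<rho> * prob (stays U m n)) \<longlonglongrightarrow> \<rho> * prob S"
    unfolding S_def
    using stays_sets[OF U]
    by (intro tendsto_mult tendsto_const finite_Lim_measure_decseq) (auto simp: decseq_def stays_def)
  ultimately have "prob S \<le> \<rho> * prob S"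
    by (intro LIMSEQ_le_const[where X = "\<lambda>n. \<rho> * prob (stays U m n)"] exI[of _ "max m N"]) auto
  then have "(1 - \<rho>) * prob S \<le> 0" by (simp add: algebra_simps)
  then have "prob S = 0"
    using \<open>\<rho> < 1\<close> measure_nonneg[of M S] by (simp add: mult_le_0_iff order_antisym)
  then show ?thesis
    unfolding S_eq using S by (simp add: null_sets_def emeasure_eq_measure)
qed

end

section \<open>The linearization at an unstable zero\<close>

text \<open>The derivative is computed componentwise by the chain rule inside the cube. Uniqueness
  of derivatives relative to a box, boundary points included, then identifies it with
  \<open>frechet_derivative\<close>.\<close>

lemma jacobian_field_F:
  fixes z :: "real ^ 'n"
  assumes z: "z \<in> cbox 0 1"
    and f: "\<And>x. x \<in> {0..1} \<Longrightarrow> (f has_real_derivative f' x) (at x within {0..1})"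
  shows "jacobian (field_F \<alpha> \<beta> q f) (at z within cbox 0 1) $ i $ j =
    \<alpha> / real CARD('n) + (if i = j then (1 - \<alpha> - \<beta>) * f' (z $ i) - 1 else 0)"
proof -
  define L where "L d = (\<chi> h. \<alpha> * mean d + (1 - \<alpha> - \<beta>) * (f' (z $ h) * (d $ h)) - d $ h)" for d :: "real ^ 'n"
  have coord: "((\<lambda>x. x $ h) has_derivative (\<lambda>d. d $ h)) (at z within cbox 0 1)" for h
    by (rule bounded_linear.has_derivative[OF bounded_linear_vec_nth has_derivative_ident])
  have fd: "((\<lambda>x. f (x $ h)) has_derivative (\<lambda>d. f' (z $ h) * (d $ h))) (at z within cbox 0 1)" for h
  proof (rule has_derivative_in_compose2[where t = "{0..1}" and g' = "\<lambda>x d. f' x * d"])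
    show "(f has_derivative (*) (f' x)) (at x within {0..1})" if "x \<in> {0..1}" for x
      using f[OF that] by (simp add: has_field_derivative_def)
  qed (use z coord in \<open>auto simp: mem_box_cart\<close>)
  have "(field_F \<alpha> \<beta> q f has_derivative L) (at z within cbox 0 1)"
  proof (subst has_derivative_componentwise_within, intro ballI)
    fix b :: "real ^ 'n" assume "b \<in> Basis"
    then obtain h where b: "b = axis h 1" by (auto simp: Basis_vec_def)
    have "((\<lambda>x. \<alpha> * mean x + \<beta> * q + (1 - \<alpha> - \<beta>) * f (x $ h) - x $ h) has_derivative
      (\<lambda>d. \<alpha> * mean d + 0 + (1 - \<alpha> - \<beta>) * (f' (z $ h) * (d $ h)) - d $ h)) (at z within cbox 0 1)"
      unfolding mean_def divide_inverse
      by (intro has_derivative_add has_derivative_diff has_derivative_mult_right has_derivative_const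
          has_derivative_mult_left has_derivative_sum coord fd)
    then show "((\<lambda>x. field_F \<alpha> \<beta> q f x \<bullet> b) has_derivative (\<lambda>x. L x \<bullet> b)) (at z within cbox 0 1)"
      by (simp add: b inner_axis field_F_def L_def)
  qed
  then have "frechet_derivative (field_F \<alpha> \<beta> q f) (at z within cbox 0 1) = L"
    using z by (intro frechet_derivative_within_cbox) (auto simp: Basis_vec_def inner_axis)
  then show ?thesis
    by (simp add: jacobian_def matrix_def L_def mean_def axis_def)
qed

text \<open>
  The moduli \<open>v\<close> of the coordinates of an unstable eigenvector satisfy \<open>J v \<ge> \<nu> v\<close>, because the
  off-diagonal entries of the Jacobian \<open>J\<close> are nonnegative.
\<close>

lemma linearly_unstable_subeigenvector:
  fixes z :: "real ^ 'n"
  assumes z: "z \<in> cbox 0 1" and "0 \<le> \<alpha>"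
    and f: "\<And>x. x \<in> {0..1} \<Longrightarrow> (f has_real_derivative f' x) (at x within {0..1})"
    and unstable: "linearly_unstable (cbox 0 1) (field_F \<alpha> \<beta> q f) z"
  obtains \<nu> :: real and v :: "'n \<Rightarrow> real" and k
  where "0 < \<nu>" "\<And>h. 0 \<le> v h" "0 < v k"
    "\<And>h. (1 + \<nu>) * v h \<le> \<alpha> * (\<Sum>i\<in>UNIV. v i) / real CARD('n) + (1 - \<alpha> - \<beta>) * f' (z $ h) * v h"
proof -
  let ?J = "jacobian (field_F \<alpha> \<beta> q f) (at z within cbox 0 1)"
  define g where "g h = (1 - \<alpha> - \<beta>) * f' (z $ h)" for h
  obtain c u where c: "0 < Re c" and u: "u \<noteq> 0" "map_matrix complex_of_real ?J *v u = c *s u"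
    using unstable by (auto simp: linearly_unstable_def complex_eigenvalue_def)
  have "(1 + Re c) * cmod (u $ h) \<le> \<alpha> * (\<Sum>i\<in>UNIV. cmod (u $ i)) / real CARD('n) + g h * cmod (u $ h)" for h
  proof -
    have J: "?J $ h $ j = \<alpha> / real CARD('n) + (if h = j then g h - 1 else 0)" for j
      unfolding g_def by (rule jacobian_field_F[OF z f])
    have "c * u $ h = (\<Sum>j\<in>UNIV. of_real (?J $ h $ j) * u $ j)"
      using arg_cong[OF u(2), of "\<lambda>w. w $ h"] by (simp add: matrix_vector_mult_def)
    also have "\<dots> = (\<Sum>j\<in>UNIV. of_real (\<alpha> / real CARD('n) + (if h = j then g h - 1 else 0)) * u $ j)"
      unfolding J ..
    also have "\<dots> = (\<Sum>j\<in>UNIV. of_real (\<alpha> / real CARD('n)) * u $ j + (if h = j then of_real (g h - 1) * u $ h else 0))"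
      by (intro sum.cong) (auto simp: algebra_simps)
    also have "\<dots> = of_real (\<alpha> / real CARD('n)) * (\<Sum>j\<in>UNIV. u $ j) + of_real (g h - 1) * u $ h"
      by (simp add: sum.distrib sum_distrib_left)
    \<comment> \<open>With the diagonal part moved to the left, moduli are taken: the real part
      bounds the left factor from below, and the triangle inequality bounds the sum from above. Thus
      \<open>Re c\<close> serves as \<nu>.\<close>
    finally have eq: "(c + 1 - of_real (g h)) * u $ h = of_real (\<alpha> / real CARD('n)) * (\<Sum>j\<in>UNIV. u $ j)"
      by (simp add: algebra_simps)
    have "(Re c + 1 - g h) * cmod (u $ h) \<le> cmod (c + 1 - of_real (g h)) * cmod (u $ h)"
      using complex_Re_le_cmod[of "c + 1 - of_real (g h)"] by (intro mult_right_mono) auto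
    also have "\<dots> = \<alpha> / real CARD('n) * cmod (\<Sum>j\<in>UNIV. u $ j)"
      using arg_cong[OF eq, of cmod] \<open>0 \<le> \<alpha>\<close> by (simp add: norm_mult norm_divide)
    also have "\<dots> \<le> \<alpha> / real CARD('n) * (\<Sum>i\<in>UNIV. cmod (u $ i))"
      using \<open>0 \<le> \<alpha>\<close> by (intro mult_left_mono norm_sum) auto
    finally show ?thesis by (simp add: algebra_simps)
  qed
  moreover obtain k where "u $ k \<noteq> 0" using u(1) by (auto simp: vec_eq_iff)
  ultimately show ?thesis
    using c by (intro that[of "Re c" "\<lambda>h. cmod (u $ h)" k]) (auto simp: g_def)
qed

section \<open>Application to the interacting chain\<close>

lemma cube_mean_bounds:
  fixes x :: "real ^ 'n"
  assumes "x \<in> cbox 0 1"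
  shows "0 \<le> mean x \<and> mean x \<le> 1"
proof -
  have "(\<Sum>i\<in>UNIV. x $ i) \<le> (\<Sum>i\<in>(UNIV :: 'n set). 1)"
    using assms by (intro sum_mono) (auto simp: mem_box_cart)
  then show ?thesis using assms by (auto simp: mean_def mem_box_cart sum_nonneg)
qed

theorem theorem2p5:
  fixes M :: "'a measure"
    and Z :: "nat \<Rightarrow> 'a \<Rightarrow> real ^ 'n"
    and I :: "nat \<Rightarrow> 'n \<Rightarrow> 'a \<Rightarrow> real"
    and r :: "nat \<Rightarrow> real"
    and f :: "real \<Rightarrow> real"
    and \<alpha> \<beta> q :: real
    and z :: "real ^ 'n"
  assumes "prob_space M"
    and "CARD('n) \<ge> 2"
    and "\<alpha> \<in> {0..<1}" and "\<beta> \<in> {0..<1}" and "\<alpha> + \<beta> \<in> {0<..<1}" and "q \<in> {0<..1}"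
    and "f ` {0..1} \<subseteq> {0..1}" and "strict_mono_on {0..1} f" and "C1_on_interval 0 1 f"
    and "\<And>n. r n \<in> {0..1}" and "(\<lambda>n. real n * r n) \<longlonglongrightarrow> 1"
    and "\<And>h. (\<lambda>\<omega>. Z 0 \<omega> $ h) \<in> borel_measurable M"
    and "\<And>h \<omega>. \<omega> \<in> space M \<Longrightarrow> Z 0 \<omega> $ h \<in> {0..1}"
    and "\<And>n h. I (Suc n) h \<in> borel_measurable M"
    and "\<And>n h \<omega>. \<omega> \<in> space M \<Longrightarrow> I (Suc n) h \<omega> \<in> {0, 1}"
    and "\<And>n h \<omega>. \<omega> \<in> space M \<Longrightarrow>
           Z (Suc n) \<omega> $ h = (1 - r n) * Z n \<omega> $ h + r n * I (Suc n) h \<omega>"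
    and "\<And>n. cond_indep_vars M (history M Z I n) (\<lambda>_. borel) (I (Suc n)) UNIV"
    and "\<And>n h. AE \<omega> in M.
           cond_probability M (history M Z I n) {\<omega> \<in> space M. I (Suc n) h \<omega> = 1} \<omega> =
           \<alpha> * mean (Z n \<omega>) + \<beta> * q + (1 - \<alpha> - \<beta>) * f (Z n \<omega> $ h)"
    and "f 0 > 0" and "f 1 < 1"
    and "z \<in> zeros_on (cbox 0 1) (field_F \<alpha> \<beta> q f)"
    and "linearly_unstable (cbox 0 1) (field_F \<alpha> \<beta> q f) z"
  shows "\<P>(\<omega> in M. (\<lambda>n. Z n \<omega>) \<longlonglongrightarrow> z) = 0"
proof -
  interpret prob_space M by fact
  have \<alpha>\<beta>: "0 \<le> \<alpha>" "0 \<le> \<beta>" "\<alpha> + \<beta> < 1" "0 < q" "q \<le> 1" using assms(3-6) by auto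
  have z: "z \<in> cbox 0 1" using assms(21) by (simp add: zeros_on_def)
  obtain f' where f': "\<And>x. x \<in> {0..1} \<Longrightarrow> (f has_real_derivative f' x) (at x within {0..1})"
    "continuous_on {0..1} f'"
    using assms(9) unfolding C1_on_interval_def by blast
  have f_mono: "f x \<le> f y" if "0 \<le> x" "x \<le> y" "y \<le> 1" for x y
    using strict_mono_onD[OF assms(8), of x y] that by (cases "x = y") auto
  obtain \<nu> v k where v: "0 < \<nu>" "\<And>h. 0 \<le> v h" "0 < v k"
    "\<And>h. (1 + \<nu>) * v h \<le> \<alpha> * (\<Sum>i\<in>UNIV. v i) / real CARD('n) + (1 - \<alpha> - \<beta>) * f' (z $ h) * v h"
  proof (rule linearly_unstable_subeigenvector[OF z \<alpha>\<beta>(1) f'(1) assms(22)])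
    fix \<nu> v k
    assume "0 < \<nu>" "\<And>h. 0 \<le> v h" "0 < v k"
      "\<And>h. (1 + \<nu>) * v h \<le> \<alpha> * (\<Sum>i\<in>UNIV. v i) / real CARD('n) + (1 - \<alpha> - \<beta>) * f' (z $ h) * v h"
    then show thesis by (rule that)
  qed
  \<comment> \<open>Clamping the coordinate to the unit interval makes \<open>p\<close> continuous
    on the whole space, hence Borel. It agrees with the given probabilities on the cube, where the
    chain lives.\<close>
  define p where "p x h = \<alpha> * mean x + \<beta> * q + (1 - \<alpha> - \<beta>) * f (max 0 (min 1 (x $ h)))" for x :: "real ^ 'n" and h
  have p_cube: "p x h = \<alpha> * mean x + \<beta> * q + (1 - \<alpha> - \<beta>) * f (x $ h)" if "x \<in> cbox 0 1" for x h
    using that by (simp add: p_def mem_box_cart)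
  have Z_cube: "Z n \<omega> \<in> cbox 0 1" if "\<omega> \<in> space M" for n \<omega>
  proof (induction n)
    case 0
    then show ?case using assms(13)[OF that] by (simp add: mem_box_cart)
  next
    case (Suc n)
    have "0 \<le> (1 - r n) * Z n \<omega> $ h + r n * I (Suc n) h \<omega> \<and> (1 - r n) * Z n \<omega> $ h + r n * I (Suc n) h \<omega> \<le> 1" for h
      using Suc assms(10)[of n] assms(15)[OF that, of n h]
      by (auto simp: mem_box_cart intro: convex_bound_le)
    then show ?case using assms(16)[OF that] by (simp add: mem_box_cart)
  qed
  have f_cont: "continuous_on {0..1} f"
    using f'(1) by (intro DERIV_continuous_on) 
  have p_measurable: "(\<lambda>x. p x h) \<in> borel_measurable borel" for h
    unfolding p_def mean_def
    by (intro borel_measurable_continuous_onI continuous_intros continuous_on_compose2[OF f_cont]) auto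
  have cond_prob: "AE \<omega> in M. cond_probability M (history M Z I n) {\<omega> \<in> space M. I (Suc n) h \<omega> = 1} \<omega> = p (Z n \<omega>) h" for n h
    using assms(18)[of n h] AE_space by eventually_elim (simp add: p_cube Z_cube)
  interpret bernoulli_chain M Z I r p
    by unfold_locales
      (rule assms(12) assms(14) assms(15) assms(16) assms(17) cond_prob p_measurable; assumption)+
  \<comment> \<open>By uniform continuity \<open>f'\<close> varies by less than
    \<open>\<nu> / 2\<close> at distance \<open>\<delta>\<close>; half of the instability rate will
    absorb this variation.\<close>
  obtain \<delta> where \<delta>: "0 < \<delta>"
    "\<And>x x'. x \<in> {0..1} \<Longrightarrow> x' \<in> {0..1} \<Longrightarrow> dist x' x < \<delta> \<Longrightarrow> dist (f' x') (f' x) < \<nu> / 2"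
    using compact_uniformly_continuous[OF f'(2)] v(1) unfolding uniformly_continuous_on_def
    by (metis compact_Icc half_gt_zero)
  define U where "U = cbox 0 1 \<inter> ball z \<delta>"
  have near: "\<bar>x $ h - z $ h\<bar> < \<delta>" if "x \<in> U" for x h
    using component_le_norm_cart[of "x - z" h] that by (simp add: U_def dist_norm norm_minus_commute)
  have U_cube: "x \<in> cbox 0 1" if "x \<in> U" for x using that by (simp add: U_def)
  \<comment> \<open>The first term bounds a success probability from below by its part with
    \<open>f 0\<close>; the second bounds the failure probability from below, since \<alpha> and
    \<beta> contribute at most \<open>\<alpha> + \<beta>\<close> to a success.\<close>
  define c where "c = min ((1 - \<alpha> - \<beta>) * f 0) ((1 - \<alpha> - \<beta>) * (1 - f 1))"
  have c: "0 < c" using \<alpha>\<beta> assms(19,20) by (simp add: c_def)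
  have p_bounds: "c \<le> p x h \<and> p x h \<le> 1 - c" if "x \<in> U" for x h
  proof -
    have x: "0 \<le> x $ h" "x $ h \<le> 1" using U_cube[OF that] by (auto simp: mem_box_cart)
    have "(1 - \<alpha> - \<beta>) * f 0 \<le> (1 - \<alpha> - \<beta>) * f (x $ h)" "(1 - \<alpha> - \<beta>) * f (x $ h) \<le> (1 - \<alpha> - \<beta>) * f 1"
      using f_mono x \<alpha>\<beta> by (auto intro!: mult_left_mono)
    moreover have "0 \<le> \<alpha> * mean x" "\<alpha> * mean x \<le> \<alpha> * 1" "0 \<le> \<beta> * q" "\<beta> * q \<le> \<beta> * 1"
      using cube_mean_bounds[OF U_cube[OF that]] \<alpha>\<beta> by (auto intro: mult_left_mono mult_left_le)
    moreover have "c \<le> (1 - \<alpha> - \<beta>) * f 0" "c \<le> (1 - \<alpha> - \<beta>) - (1 - \<alpha> - \<beta>) * f 1"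
      by (auto simp: c_def right_diff_distrib)
    ultimately show ?thesis unfolding p_cube[OF U_cube[OF that]] by linarith
  qed
  have mean_diff: "mean y - mean x = (\<Sum>i\<in>UNIV. y $ i - x $ i) / real CARD('n)" for x y :: "real ^ 'n"
    by (simp add: mean_def sum_subtractf diff_divide_distrib)
  have p_mono: "p x h \<le> p y h" if "x \<in> U" "y \<in> U" "\<And>h. x $ h \<le> y $ h" for x y h
  proof -
    have "mean x \<le> mean y" unfolding mean_def using that(3) by (intro divide_right_mono sum_mono) auto
    moreover have "f (x $ h) \<le> f (y $ h)"
      using f_mono U_cube that by (auto simp: mem_box_cart)
    ultimately show ?thesis
      unfolding p_cube[OF U_cube[OF that(1)]] p_cube[OF U_cube[OF that(2)]]
      using \<alpha>\<beta> by (intro add_mono mult_left_mono) auto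
  qed
  have drift: "(1 + \<nu> / 2) * (\<Sum>h\<in>UNIV. v h * (y $ h - x $ h)) \<le> (\<Sum>h\<in>UNIV. v h * (p y h - p x h))"
    if xy: "x \<in> U" "y \<in> U" "\<And>h. x $ h \<le> y $ h" for x y
  proof -
    \<comment> \<open>The mean value theorem is applied between \<open>x\<close> and
      \<open>y\<close>, not between a point and \<open>z\<close>. The intermediate point is within
      \<open>\<delta>\<close> of \<open>z $ h\<close>, so the error is proportional to
      \<open>y $ h - x $ h\<close>.\<close>
    have f_diff: "((1 - \<alpha> - \<beta>) * f' (z $ h) - \<nu> / 2) * (y $ h - x $ h) \<le> (1 - \<alpha> - \<beta>) * (f (y $ h) - f (x $ h))" for h
    proof -
      have x01: "0 \<le> x $ h" and y01: "y $ h \<le> 1" and z01: "z $ h \<in> {0..1}"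
        using xy(1,2)[THEN U_cube] z by (auto simp: mem_box_cart)
      have "(f has_derivative (*) (f' t)) (at t within {x $ h..y $ h})" if "x $ h \<le> t" "t \<le> y $ h" for t
        using has_derivative_subset[OF f'(1)[of t, unfolded has_field_derivative_def]] that x01 y01 by auto
      then obtain t where t: "t \<in> {x $ h..y $ h}" "f (y $ h) - f (x $ h) = f' t * (y $ h - x $ h)"
        using mvt_very_simple[OF xy(3)[of h], of f "\<lambda>t. (*) (f' t)"] by auto
      have "dist t (z $ h) < \<delta>"
        using t(1) near[OF xy(1), of h] near[OF xy(2), of h] by (auto simp: dist_real_def)
      then have "\<bar>f' t - f' (z $ h)\<bar> < \<nu> / 2"
        using \<delta>(2)[of "z $ h" t] t(1) x01 y01 z01 by (auto simp: dist_real_def)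
      then have "(1 - \<alpha> - \<beta>) * (f' (z $ h) - f' t) \<le> (1 - \<alpha> - \<beta>) * (\<nu> / 2)"
        using \<alpha>\<beta> by (intro mult_left_mono) linarith+
      also have "\<dots> \<le> 1 * (\<nu> / 2)"
        using \<alpha>\<beta> v(1) by (intro mult_right_mono) auto
      finally have "((1 - \<alpha> - \<beta>) * f' (z $ h) - \<nu> / 2) * (y $ h - x $ h) \<le> ((1 - \<alpha> - \<beta>) * f' t) * (y $ h - x $ h)"
        using xy(3)[of h] by (intro mult_right_mono) (auto simp: algebra_simps)
      then show ?thesis by (simp add: t(2) mult.assoc)
    qed
    have "(1 + \<nu> / 2) * (\<Sum>h\<in>UNIV. v h * (y $ h - x $ h)) =
        (\<Sum>h\<in>UNIV. ((1 + \<nu>) * v h - \<nu> / 2 * v h) * (y $ h - x $ h))"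
      unfolding sum_distrib_left by (intro sum.cong) (auto simp: field_simps)
    also have "\<dots> \<le> (\<Sum>h\<in>UNIV. ((\<alpha> * (\<Sum>i\<in>UNIV. v i) / real CARD('n) + (1 - \<alpha> - \<beta>) * f' (z $ h) * v h) - \<nu> / 2 * v h) * (y $ h - x $ h))"
      using v(4) xy(3) by (intro sum_mono mult_right_mono diff_right_mono) auto
    also have "\<dots> = (\<Sum>h\<in>UNIV. \<alpha> * (\<Sum>i\<in>UNIV. v i) / real CARD('n) * (y $ h - x $ h))
        + (\<Sum>h\<in>UNIV. v h * (((1 - \<alpha> - \<beta>) * f' (z $ h) - \<nu> / 2) * (y $ h - x $ h)))"
      unfolding sum.distrib[symmetric] by (intro sum.cong) (auto simp: field_simps)
    \<comment> \<open>The interaction matrix is symmetric: averaging the weights \<open>v\<close>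
      against the increments equals weighting the averaged increment by \<open>v\<close>.\<close>
    also have "(\<Sum>h\<in>UNIV. \<alpha> * (\<Sum>i\<in>UNIV. v i) / real CARD('n) * (y $ h - x $ h)) = (\<Sum>h\<in>UNIV. v h * (\<alpha> * (mean y - mean x)))"
      unfolding mean_diff sum_distrib_left[symmetric] sum_distrib_right[symmetric] by simp
    also have "(\<Sum>h\<in>UNIV. v h * (((1 - \<alpha> - \<beta>) * f' (z $ h) - \<nu> / 2) * (y $ h - x $ h)))
        \<le> (\<Sum>h\<in>UNIV. v h * ((1 - \<alpha> - \<beta>) * (f (y $ h) - f (x $ h))))"
      using v(2) f_diff by (intro sum_mono mult_left_mono) auto
    also have "(\<Sum>h\<in>UNIV. v h * (\<alpha> * (mean y - mean x))) + (\<Sum>h\<in>UNIV. v h * ((1 - \<alpha> - \<beta>) * (f (y $ h) - f (x $ h))))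
        = (\<Sum>h\<in>UNIV. v h * (p y h - p x h))"
      unfolding sum.distrib[symmetric] p_cube[OF U_cube[OF xy(1)]] p_cube[OF U_cube[OF xy(2)]]
      by (intro sum.cong) (auto simp: algebra_simps)
    finally show ?thesis by simp
  qed
  have diam: "(\<Sum>h\<in>UNIV. v h * (y $ h - x $ h)) \<le> (\<Sum>h\<in>UNIV. v h * 1)" if "x \<in> U" "y \<in> U" for x y
  proof (intro sum_mono mult_left_mono)
    fix h
    have "0 \<le> x $ h" "y $ h \<le> 1" using that[THEN U_cube] by (auto simp: mem_box_cart)
    then show "y $ h - x $ h \<le> 1" by linarith
  qed (rule v)
  have "{\<omega> \<in> space M. \<forall>n\<ge>m. Z n \<omega> \<in> U} \<in> null_sets M" for m
    using assms(10,11) v(1)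
    by (intro prob_stays_forever_eq_0[where U = U and c = c and v = v and k = k and \<mu> = "\<nu> / 2",
          OF _ c p_bounds p_mono _ drift diam v(2,3)]) (auto simp: U_def)
  then have null: "(\<Union>m. {\<omega> \<in> space M. \<forall>n\<ge>m. Z n \<omega> \<in> U}) \<in> null_sets M"
    by (intro null_sets_UN) auto
  \<comment> \<open>A convergent path is eventually in the ball, and always in the cube, so it stays
    in \<open>U\<close> from some \<open>m\<close> on.\<close>
  have "{\<omega> \<in> space M. (\<lambda>n. Z n \<omega>) \<longlonglongrightarrow> z} \<subseteq> (\<Union>m. {\<omega> \<in> space M. \<forall>n\<ge>m. Z n \<omega> \<in> U})"
  proof safe
    fix \<omega> assume \<omega>: "\<omega> \<in> space M" "(\<lambda>n. Z n \<omega>) \<longlonglongrightarrow> z"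
    then obtain m where "\<And>n. m \<le> n \<Longrightarrow> dist (Z n \<omega>) z < \<delta>"
      using \<delta>(1) unfolding lim_sequentially by blast
    then show "\<omega> \<in> (\<Union>m. {\<omega> \<in> space M. \<forall>n\<ge>m. Z n \<omega> \<in> U})"
      using \<omega>(1) Z_cube[OF \<omega>(1)] by (auto simp: U_def dist_commute)
  qed
  then have "measure M {\<omega> \<in> space M. (\<lambda>n. Z n \<omega>) \<longlonglongrightarrow> z} \<le> measure M (\<Union>m. {\<omega> \<in> space M. \<forall>n\<ge>m. Z n \<omega> \<in> U})"
    by (rule finite_measure_mono[OF _ null_setsD2[OF null]])
  also have "\<dots> = 0" by (rule measure_eq_0_null_sets[OF null])
  finally show ?thesis by (simp add: measure_le_0_iff)
qed

end
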